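(* Let $u_h\in X_h$ be the unique solution of the space semi-discrete problem $\mathcal{B}_h u_h=(f_h,u_{0h})$ in $Z_h'$, and let $u_{hk}\in X_{hk}$ be the unique minimizer over $X_{hk}$ of the functional $$\mathcal{E}_h(x_{h})=\tfrac12\left(\|\mathcal{A}_h x_{h}-f_h\|_{Y_h'}^2+\alpha\|x_{h}(0)-u_{0h}\|_L^2\right).$$ Then $$\|u_h-u_{hk}\|_{X_h}\le C\inf_{x_{hk}\in X_{hk}}\|u_h-x_{hk}\|_{X_h},\qquad C=\frac{\sqrt3\,M}{\beta},$$ where $\beta=\frac{\alpha^2}{M}(1+\kappa^2)^{-1/2}$ and $\kappa=\operatorname{ess\,sup}_{t\in I}\frac12\|A(t)A(t)^{-\mathrm T}-I\|_{\mathcal{L}(V';V')}$ (inside this operator norm $I$ denotes the identity of $V'$). In particular, $C$ is independent of the time discretization, i.e. of the choice of the finite-dimensional space $S_k$.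
   Context: Continuous setting. $V\hookrightarrow L\equiv L'\hookrightarrow V'$ is a Gelfand triple of separable real Hilbert spaces (dense continuous embeddings), with norms $\|\cdot\|_V$, $\|\cdot\|_L$, and $V'$ carries the dual norm. $T>0$, $I=(0,T)$. $A:I\to\mathcal{L}(V,V')$ is strongly measurable, and there are constants $0<\alpha\le M<\infty$ such that for a.e. $t\in I$ and all $v\in V$: $\|A(t)v\|_{V'}\le M\|v\|_V$ and $\langle A(t)v,v\rangle_{V',V}\ge\alpha\|v\|_V^2$. $A(t)$ need not be selfadjoint. $A(t)^{-\mathrm T}\in\mathcal{L}(V';V)$ denotes the inverse of the adjoint of $A(t)$. The data are $f\in L^2(I;V')$ and $u_0\in L$. It is also assumed that $A(t)=\sum_{p=1}^P\mu^{(p)}(t)A^{(p)}$ and $f(t)=\sum_{q=1}^Q\lambda^{(q)}(t)f^{(q)}$ for some positive integers $P,Q$, with $\mu^{(p)}\in L^\infty(I)$, $A^{(p)}\in\mathcal{L}(V,V')$, $\lambda^{(q)}\in L^2(I)$, $f^{(q)}\in V'$. Discrete setting. $V_h\subset V$ and $S_k\subset H^1(I)$ are finite-dimensional subspaces. $V_h$ carries the norm of $V$ and $V_h'$ the corresponding dual norm $\|\varphi\|_{V_h'}=\sup_{0\ne v_h\in V_h}\langle\varphi,v_h\rangle/\|v_h\|_V$. $L_h$ is the space $V_h$ equipped with the norm of $L$. Set $X_{hk}=V_h\otimes S_k$, $X_h=V_h\otimes H^1(I)$, $Y_h=L^2(I;V_h)$, $Y_h'=L^2(I;V_h')$, $Z_h=Y_h\times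 L_h$, $Z_h'=Y_h'\times L_h'$. $f_h\in Y_h'$ is defined by $f_h(t)=f(t)|_{V_h}$ for a.e. $t$, and $u_{0h}$ is the $L$-orthogonal projection of $u_0$ onto $V_h$. The operator $\mathcal{A}_h:X_h\to Y_h'$ is defined, for a.e. $t\in I$ and all $w_h\in V_h$, by $$\langle(\mathcal{A}_hx_h)(t),w_h\rangle_{V_h',V_h}=\langle\partial_tx_h(t),w_h\rangle_L+\langle A(t)x_h(t),w_h\rangle_{V',V}.$$ The operator $\mathcal{B}_h:X_h\to Z_h'$ is $\mathcal{B}_hx_h=(\mathcal{A}_hx_h,x_h(0))$, i.e. $\langle\mathcal{B}_hx_h,(y_h,g_h)\rangle_{Z_h',Z_h}=\int_I\langle(\mathcal{A}_hx_h)(t),y_h(t)\rangle_{V_h',V_h}\,dt+\langle x_h(0),g_h\rangle_L$. The pair $(f_h,u_{0h})$ is viewed as an element of $Z_h'$ in the same way. Norm on $X_h$: $\|x_h\|_{X_h}^2=\|x_h\|_{L^2(I;V)}^2+M^{-2}\|\partial_tx_h\|_{L^2(I;V_h')}^2+\alpha^{-1}\|x_h(T)\|_L^2$, where $\partial_tx_h(t)\in V_h$ is identified with the element $w_h\mapsto\langle\partial_tx_h(t),w_h\rangle_L$ of $V_h'$. *)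

theory Defs
  imports "HOL-Analysis.Analysis" "HOL-Probability.Essential_Supremum"
begin

text \<open>
  \<open>V\<close> and \<open>L\<close> are types of sort \<open>{banach, real_inner, second_countable_topology}\<close> (separable real
  Hilbert spaces), \<open>V' = 'v \<Rightarrow>\<^sub>L real\<close> with its operator norm, and the embedding of \<open>V\<close> into \<open>L\<close> is
  a bounded linear map \<open>j\<close>. An element \<open>l\<close> of \<open>L\<close> acts on \<open>V\<close> by \<open>v \<mapsto> l \<bullet> j v\<close>.
  The density of \<open>L\<close> in \<open>V'\<close> is a consequence of the injectivity of \<open>j\<close>.
\<close>

definition gelfand_embedding ::
  "(('v::{banach, real_inner, second_countable_topology}) \<Rightarrow>\<^sub>L
    ('l::{banach, real_inner, second_countable_topology})) \<Rightarrow> bool" where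
  "gelfand_embedding j \<longleftrightarrow> inj (blinfun_apply j) \<and> closure (range (blinfun_apply j)) = UNIV"


section \<open>Function spaces on the interval \<open>I = (0, T)\<close>\<close>

abbreviation meas_I :: "real \<Rightarrow> real measure" where
  "meas_I T \<equiv> lebesgue_on {0<..<T}"

definition strongly_measurable :: "'a measure \<Rightarrow> ('a \<Rightarrow> 'b::real_normed_vector) \<Rightarrow> bool" where
  "strongly_measurable N f \<longleftrightarrow>
     (\<exists>s. (\<forall>n::nat. simple_function N (s n)) \<and> (AE t in N. (\<lambda>n. s n t) \<longlonglongrightarrow> f t))"

definition L2 :: "real \<Rightarrow> (real \<Rightarrow> 'b::real_normed_vector) set" where
  "L2 T = {f. strongly_measurable (meas_I T) f \<and> integrable (meas_I T) (\<lambda>t. (norm (f t))\<^sup>2)}"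

definition Linfty :: "real \<Rightarrow> (real \<Rightarrow> 'b::real_normed_vector) set" where
  "Linfty T = {f. strongly_measurable (meas_I T) f \<and> (\<exists>c. AE t in meas_I T. norm (f t) \<le> c)}"

definition L2_norm :: "real \<Rightarrow> (real \<Rightarrow> 'b::real_normed_vector) \<Rightarrow> real" where
  "L2_norm T f = sqrt (LINT t|meas_I T. (norm (f t))\<^sup>2)"

text \<open>Weak derivatives are tested with continuously differentiable functions that are compactly
  supported in \<open>(0, T)\<close>.\<close>

definition test_fun :: "real \<Rightarrow> (real \<Rightarrow> real) \<Rightarrow> bool" where
  "test_fun T \<phi> \<longleftrightarrow> \<phi> C1_differentiable_on UNIV \<and>
     (\<exists>a b. 0 < a \<and> b < T \<and> (\<forall>t. t \<notin> {a..b} \<longrightarrow> \<phi> t = 0))"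

definition has_weak_deriv ::
  "real \<Rightarrow> (real \<Rightarrow> 'b::{banach, second_countable_topology}) \<Rightarrow> (real \<Rightarrow> 'b) \<Rightarrow> bool" where
  "has_weak_deriv T x g \<longleftrightarrow>
     (\<forall>\<phi>. test_fun T \<phi> \<longrightarrow>
        (LINT t|meas_I T. deriv \<phi> t *\<^sub>R x t) = - (LINT t|meas_I T. \<phi> t *\<^sub>R g t))"

text \<open>A class in \<open>H\<^sup>1(I)\<close> is represented by its continuous representative on \<open>[0, T]\<close>, so that the
  point values at \<open>0\<close> and \<open>T\<close> make sense. The representative is extended by zero to the real line,
  so that equality of functions is equality in \<open>H\<^sup>1(I)\<close>.\<close>

definition H1 :: "real \<Rightarrow> (real \<Rightarrow> 'b::{banach, second_countable_topology}) set" where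
  "H1 T = {x \<in> L2 T. (\<exists>g \<in> L2 T. has_weak_deriv T x g) \<and>
             continuous_on {0..T} x \<and> (\<forall>t. t \<notin> {0..T} \<longrightarrow> x t = 0)}"

text \<open>The weak derivative is determined up to a null set.\<close>

definition weak_deriv ::
  "real \<Rightarrow> (real \<Rightarrow> 'b::{banach, second_countable_topology}) \<Rightarrow> (real \<Rightarrow> 'b)" where
  "weak_deriv T x = (SOME g. g \<in> L2 T \<and> has_weak_deriv T x g)"

text \<open>Finite-dimensional linear subspaces of a space of real functions; \<open>n = 0\<close> gives \<open>{0}\<close>.\<close>

definition fin_dim_fun_space :: "(real \<Rightarrow> real) set \<Rightarrow> bool" where
  "fin_dim_fun_space S \<longleftrightarrow>
     (\<exists>(n::nat) b. S = {(\<lambda>t. \<Sum>i<n. c i * b i t) | c. True})"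

text \<open>The algebraic tensor product \<open>V\<^sub>h \<otimes> S\<close>, realized as a space of functions of time.\<close>

definition tensor :: "'v::real_vector set \<Rightarrow> (real \<Rightarrow> real) set \<Rightarrow> (real \<Rightarrow> 'v) set" where
  "tensor Vh S = {x. \<exists>(n::nat) v s. (\<forall>i<n. v i \<in> Vh \<and> s i \<in> S) \<and>
                       x = (\<lambda>t. \<Sum>i<n. s i t *\<^sub>R v i)}"


section \<open>The constants\<close>

text \<open>The adjoint of an operator from \<open>V\<close> to \<open>V'\<close>, again from \<open>V\<close> to \<open>V'\<close> by reflexivity.\<close>

definition adjoint_op ::
  "('v::real_normed_vector \<Rightarrow>\<^sub>L ('v \<Rightarrow>\<^sub>L real)) \<Rightarrow> 'v \<Rightarrow> ('v \<Rightarrow>\<^sub>L real)" where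
  "adjoint_op a v = Blinfun (\<lambda>w. a w v)"

definition kappa ::
  "real \<Rightarrow> (real \<Rightarrow> 'v::{banach, real_inner, second_countable_topology} \<Rightarrow>\<^sub>L ('v \<Rightarrow>\<^sub>L real)) \<Rightarrow> real" where
  "kappa T A = real_of_ereal (esssup (meas_I T)
     (\<lambda>t. ereal (1 / 2 * onorm (\<lambda>\<phi>. A t (inv (adjoint_op (A t)) \<phi>) - \<phi>))))"

definition beta_const ::
  "real \<Rightarrow> real \<Rightarrow> real \<Rightarrow> (real \<Rightarrow> 'v::{banach, real_inner, second_countable_topology} \<Rightarrow>\<^sub>L ('v \<Rightarrow>\<^sub>L real)) \<Rightarrow> real"
  where
  "beta_const \<alpha> M T A = \<alpha>\<^sup>2 / M * (1 + (kappa T A)\<^sup>2) powr (- 1 / 2)"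


section \<open>The space semi-discrete problem\<close>

text \<open>Elements of \<open>V\<^sub>h'\<close> are given by functions on \<open>V\<close>, of which only the values on \<open>V\<^sub>h\<close> matter.
  The vector \<open>0\<close> contributes \<open>\<phi> 0 / 0 = 0\<close> to the supremum, which gives the value \<open>0\<close>
  for \<open>V\<^sub>h = {0}\<close> and changes nothing otherwise.\<close>

definition dual_norm :: "'v::real_normed_vector set \<Rightarrow> ('v \<Rightarrow> real) \<Rightarrow> real" where
  "dual_norm Vh \<phi> = (SUP v\<in>Vh. \<phi> v / norm v)"

text \<open>The norm of \<open>L\<^sup>2(I; V\<^sub>h')\<close>.\<close>

definition Yh'_norm :: "real \<Rightarrow> 'v::real_normed_vector set \<Rightarrow> (real \<Rightarrow> 'v \<Rightarrow> real) \<Rightarrow> real" where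
  "Yh'_norm T Vh F = sqrt (LINT t|meas_I T. (dual_norm Vh (F t))\<^sup>2)"

definition Yh :: "real \<Rightarrow> 'v::real_normed_vector set \<Rightarrow> (real \<Rightarrow> 'v) set" where
  "Yh T Vh = {y \<in> L2 T. AE t in meas_I T. y t \<in> Vh}"

abbreviation Xh :: "real \<Rightarrow> 'v::real_vector set \<Rightarrow> (real \<Rightarrow> 'v) set" where
  "Xh T Vh \<equiv> tensor Vh (H1 T)"

definition Ah ::
  "real \<Rightarrow> (('v::{banach, real_inner, second_countable_topology}) \<Rightarrow>\<^sub>L
    ('l::{banach, real_inner, second_countable_topology})) \<Rightarrow>
   (real \<Rightarrow> 'v \<Rightarrow>\<^sub>L ('v \<Rightarrow>\<^sub>L real)) \<Rightarrow> (real \<Rightarrow> 'v) \<Rightarrow> real \<Rightarrow> 'v \<Rightarrow> real" where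
  "Ah T j A x = (\<lambda>t w. j (weak_deriv T x t) \<bullet> j w + A t (x t) w)"

text \<open>The functional on \<open>Z\<^sub>h = Y\<^sub>h \<times> L\<^sub>h\<close> given by a pair in \<open>Y\<^sub>h' \<times> V\<^sub>h\<close>.\<close>

definition Zh'_elem ::
  "real \<Rightarrow> (('v::{banach, real_inner, second_countable_topology}) \<Rightarrow>\<^sub>L
    ('l::{banach, real_inner, second_countable_topology})) \<Rightarrow>
   (real \<Rightarrow> 'v \<Rightarrow> real) \<Rightarrow> 'v \<Rightarrow> (real \<Rightarrow> 'v) \<times> 'v \<Rightarrow> real" where
  "Zh'_elem T j F a = (\<lambda>(y, g). (LINT t|meas_I T. F t (y t)) + j a \<bullet> j g)"

definition Bh ::
  "real \<Rightarrow> (('v::{banach, real_inner, second_countable_topology}) \<Rightarrow>\<^sub>L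
    ('l::{banach, real_inner, second_countable_topology})) \<Rightarrow>
   (real \<Rightarrow> 'v \<Rightarrow>\<^sub>L ('v \<Rightarrow>\<^sub>L real)) \<Rightarrow> (real \<Rightarrow> 'v) \<Rightarrow> (real \<Rightarrow> 'v) \<times> 'v \<Rightarrow> real" where
  "Bh T j A x = Zh'_elem T j (Ah T j A x) (x 0)"

text \<open>The load \<open>f\<^sub>h(t)\<close>, i.e. the restriction of \<open>f(t)\<close> to \<open>V\<^sub>h\<close>.\<close>

definition load_h :: "(real \<Rightarrow> 'v::real_normed_vector \<Rightarrow>\<^sub>L real) \<Rightarrow> real \<Rightarrow> 'v \<Rightarrow> real" where
  "load_h f = (\<lambda>t w. f t w)"

text \<open>The \<open>L\<close>-orthogonal projection onto \<open>V\<^sub>h\<close>, as an element of \<open>V\<^sub>h\<close>.\<close>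

definition L_proj ::
  "(('v::{banach, real_inner, second_countable_topology}) \<Rightarrow>\<^sub>L
    ('l::{banach, real_inner, second_countable_topology})) \<Rightarrow> 'v set \<Rightarrow> 'l \<Rightarrow> 'v" where
  "L_proj j Vh u0 = (THE p. p \<in> Vh \<and> (\<forall>w\<in>Vh. (u0 - j p) \<bullet> j w = 0))"

definition semidiscrete_solution ::
  "real \<Rightarrow> (('v::{banach, real_inner, second_countable_topology}) \<Rightarrow>\<^sub>L
    ('l::{banach, real_inner, second_countable_topology})) \<Rightarrow>
   (real \<Rightarrow> 'v \<Rightarrow>\<^sub>L ('v \<Rightarrow>\<^sub>L real)) \<Rightarrow> 'v set \<Rightarrow> (real \<Rightarrow> 'v \<Rightarrow>\<^sub>L real) \<Rightarrow> 'l \<Rightarrow>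
   (real \<Rightarrow> 'v) \<Rightarrow> bool" where
  "semidiscrete_solution T j A Vh f u0 u \<longleftrightarrow>
     u \<in> Xh T Vh \<and>
     (\<forall>z \<in> Yh T Vh \<times> Vh. Bh T j A u z = Zh'_elem T j (load_h f) (L_proj j Vh u0) z)"

definition energy_h ::
  "real \<Rightarrow> (('v::{banach, real_inner, second_countable_topology}) \<Rightarrow>\<^sub>L
    ('l::{banach, real_inner, second_countable_topology})) \<Rightarrow>
   (real \<Rightarrow> 'v \<Rightarrow>\<^sub>L ('v \<Rightarrow>\<^sub>L real)) \<Rightarrow> 'v set \<Rightarrow> real \<Rightarrow> (real \<Rightarrow> 'v \<Rightarrow>\<^sub>L real) \<Rightarrow> 'l \<Rightarrow>
   (real \<Rightarrow> 'v) \<Rightarrow> real" where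
  "energy_h T j A Vh \<alpha> f u0 x =
     1 / 2 * ((Yh'_norm T Vh (\<lambda>t w. Ah T j A x t w - load_h f t w))\<^sup>2
              + \<alpha> * (norm (j (x 0 - L_proj j Vh u0)))\<^sup>2)"

definition Xh_norm ::
  "real \<Rightarrow> (('v::{banach, real_inner, second_countable_topology}) \<Rightarrow>\<^sub>L
    ('l::{banach, real_inner, second_countable_topology})) \<Rightarrow>
   'v set \<Rightarrow> real \<Rightarrow> real \<Rightarrow> (real \<Rightarrow> 'v) \<Rightarrow> real" where
  "Xh_norm T j Vh \<alpha> M x =
     sqrt ((L2_norm T x)\<^sup>2
           + 1 / M\<^sup>2 * (Yh'_norm T Vh (\<lambda>t w. j (weak_deriv T x t) \<bullet> j w))\<^sup>2
           + 1 / \<alpha> * (norm (j (x T)))\<^sup>2)"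

end

theory Submission
  imports Defs
begin

text \<open>
  Because \<open>\<A>\<^sub>h u\<^sub>h = f\<^sub>h\<close> and \<open>u\<^sub>h(0) = u\<^sub>0\<^sub>h\<close>, the functional \<open>\<E>\<^sub>h\<close> at \<open>x\<close> is half of the residual energy
  \<open>R(y) = |\<A>\<^sub>h y|\<^sup>2 + \<alpha> |y(0)|\<^sup>2\<close> of the error \<open>y = u\<^sub>h - x\<close>, where values
  at \<open>0\<close> and \<open>T\<close> are measured in \<open>L\<close>. The minimizer therefore has the least residual energy of the error
  among all competitors, and quasi-optimality in another norm follows once the square of that norm
  is equivalent to \<open>R\<close>; the constant is the square root of the ratio of the two equivalence
  constants. Here (lemma \<open>residual_energy_bounds\<close>)
  \<open>\<alpha>\<^sup>2 / 2 |y|\<^sup>2 \<le> R(y) \<le> 3 / 2 (M\<^sup>4 / \<alpha>\<^sup>2) |y|\<^sup>2\<close> with the norm of \<open>X\<^sub>h\<close>, which gives the constant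
  \<open>\<surd>3 M\<^sup>2 / \<alpha>\<^sup>2\<close>. This is at most \<open>\<surd>3 M / \<beta>\<close>, since \<open>\<beta> \<le> \<alpha>\<^sup>2 / M\<close>.

  The equivalence is a pointwise statement in time. On the finite-dimensional space \<open>V\<^sub>h\<close> the time
  derivative of \<open>y\<close> and \<open>A y\<close> have Riesz representatives \<open>r\<close> and \<open>a\<close>, with respect to the inner product
  of \<open>V\<close>, and \<open>2 \<integral> r \<bullet> y = |y(T)|\<^sup>2 - |y(0)|\<^sup>2\<close> (lemma \<open>energy_identity\<close>). This removes the initial value
  from \<open>R(y) = \<integral> (|r + a|\<^sup>2 - 2 \<alpha> r \<bullet> y) + \<alpha> |y(T)|\<^sup>2\<close>, and the integrand is comparable with
  \<open>|y|\<^sup>2 + |r|\<^sup>2 / M\<^sup>2\<close> by algebra in an inner product space (lemmas \<open>residual_density_lower\<close> and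
  \<open>residual_density_upper\<close>), using only \<open>a \<bullet> y \<ge> \<alpha> |y|\<^sup>2\<close> and \<open>|a| \<le> M |y|\<close>.

  What remains is one-dimensional Sobolev calculus for Hilbert-space-valued functions. It rests on the
  formula \<open>x(b) = x(0) + \<integral>\<^sub>0\<^sup>b x'\<close> (lemma \<open>weak_deriv_integral\<close>), obtained by testing with smoothed
  indicators of \<open>(0, b)\<close>. The formula yields both the energy identity and the uniqueness of weak
  derivatives, hence the linearity of the error equation in spite of the choice of a representative
  in \<open>weak_deriv\<close>.
\<close>


section \<open>Pointwise comparison of the residual with the graph norm\<close>

text \<open>
  The shift by \<open>\<alpha> x\<close> costs nothing but gains \<open>\<alpha>\<^sup>2\<close> in the bound: coercivity makes the cross term
  of the square at most \<open>-2 \<alpha>\<^sup>2 |x|\<^sup>2\<close>. For \<open>M = \<alpha>\<close> the shifted vector vanishes, which is why the two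
  comparisons below stay sharp enough near that case.
\<close>

lemma coercive_shift_bound:
  fixes a x :: "'a::real_inner"
  assumes \<alpha>: "0 < \<alpha>" and coer: "a \<bullet> x \<ge> \<alpha> * (norm x)\<^sup>2" and bd: "norm a \<le> M * norm x"
  shows "(a - \<alpha> *\<^sub>R x) \<bullet> (a - \<alpha> *\<^sub>R x) \<le> (M\<^sup>2 - \<alpha>\<^sup>2) * (x \<bullet> x)"
proof -
  have "a \<bullet> a \<le> M\<^sup>2 * (x \<bullet> x)"
    using power_mono[OF bd, of 2] by (simp add: power2_norm_eq_inner power_mult_distrib)
  moreover have "(a - \<alpha> *\<^sub>R x) \<bullet> (a - \<alpha> *\<^sub>R x) = a \<bullet> a - 2 * \<alpha> * (a \<bullet> x) + \<alpha>\<^sup>2 * (x \<bullet> x)"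
    by (simp add: algebra_simps inner_commute power2_eq_square)
  moreover have "2 * \<alpha> * (a \<bullet> x) \<ge> 2 * \<alpha> * (\<alpha> * (x \<bullet> x))"
    using coer \<alpha> by (simp add: power2_norm_eq_inner)
  ultimately have "(a - \<alpha> *\<^sub>R x) \<bullet> (a - \<alpha> *\<^sub>R x) \<le> M\<^sup>2 * (x \<bullet> x) - \<alpha>\<^sup>2 * (x \<bullet> x)"
    by (simp only: power2_eq_square)
  then show ?thesis by (simp only: left_diff_distrib)
qed

text \<open>
  Completing the square gives \<open>|r + a|\<^sup>2 - 2 \<alpha> r \<bullet> x = |l|\<^sup>2 + 2 \<alpha> a \<bullet> x - \<alpha>\<^sup>2 |x|\<^sup>2\<close> with
  \<open>l = r + a - \<alpha> x\<close>, hence control of \<open>|l|\<^sup>2 + \<alpha>\<^sup>2 |x|\<^sup>2\<close>. The vector \<open>r\<close> is recovered as the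
  difference of \<open>l\<close> and \<open>a - \<alpha> x\<close>, the latter being controlled by \<open>x\<close>.
\<close>

lemma residual_density_lower:
  fixes r a x :: "'a::real_inner"
  assumes \<alpha>: "0 < \<alpha>" "\<alpha> \<le> M" and coer: "a \<bullet> x \<ge> \<alpha> * (norm x)\<^sup>2" and bd: "norm a \<le> M * norm x"
  shows "\<alpha>\<^sup>2 / 2 * ((norm x)\<^sup>2 + 1 / M\<^sup>2 * (norm r)\<^sup>2) \<le> (norm (r + a))\<^sup>2 - 2 * \<alpha> * (r \<bullet> x)"
proof -
  define q where "q = M\<^sup>2 / \<alpha>\<^sup>2"
  have q: "q \<ge> 1" unfolding q_def using \<alpha> by (simp add: divide_simps power_mono)
  have Mq: "M\<^sup>2 = q * \<alpha>\<^sup>2" unfolding q_def using \<alpha> by simp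
  define l where "l = r + a - \<alpha> *\<^sub>R x"
  define e where "e = a - \<alpha> *\<^sub>R x"
  have e: "e \<bullet> e \<le> (M\<^sup>2 - \<alpha>\<^sup>2) * (x \<bullet> x)"
    unfolding e_def by (rule coercive_shift_bound[OF \<alpha>(1) coer bd])
  have main: "(norm (r + a))\<^sup>2 - 2 * \<alpha> * (r \<bullet> x) \<ge> l \<bullet> l + \<alpha>\<^sup>2 * (x \<bullet> x)"
  proof -
    have "(norm (r + a))\<^sup>2 - 2 * \<alpha> * (r \<bullet> x) = l \<bullet> l + 2 * \<alpha> * (a \<bullet> x) - \<alpha>\<^sup>2 * (x \<bullet> x)"
      unfolding l_def power2_norm_eq_inner by (simp add: algebra_simps inner_commute power2_eq_square)
    moreover have "2 * \<alpha> * (a \<bullet> x) \<ge> 2 * \<alpha> * (\<alpha> * (x \<bullet> x))"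
      using coer \<alpha>(1) by (simp add: power2_norm_eq_inner)
    ultimately show ?thesis by (simp add: algebra_simps power2_eq_square)
  qed
  have r: "r = l - e" unfolding l_def e_def by simp
  \<comment> \<open>Young's inequality for \<open>|l - e|\<^sup>2\<close>, weighted so that \<open>l\<close> gets exactly the factor \<open>2 q\<close>;
    \<open>e\<close> then gets \<open>2 q / (2 q - 1)\<close>, and \<open>2 (q - 1) / (2 q - 1) \<le> 1\<close>.\<close>
  have young: "(2 * q - 1) * (r \<bullet> r) \<le> (2 * q - 1) * (2 * q) * (l \<bullet> l) + 2 * q * (e \<bullet> e)"
  proof -
    have "0 \<le> ((2 * q - 1) *\<^sub>R l + e) \<bullet> ((2 * q - 1) *\<^sub>R l + e)" by simp
    then show ?thesis unfolding r by (simp add: algebra_simps inner_commute)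
  qed
  have "2 * q * (e \<bullet> e) \<le> 2 * q * ((q - 1) * (\<alpha>\<^sup>2 * (x \<bullet> x)))"
    using e q unfolding Mq by (intro mult_left_mono) (auto simp: algebra_simps)
  also have "\<dots> \<le> (2 * q - 1) * (q * (\<alpha>\<^sup>2 * (x \<bullet> x)))"
  proof -
    have "2 * q * (q - 1) \<le> (2 * q - 1) * q" using q by (simp add: algebra_simps)
    from mult_right_mono[OF this, of "\<alpha>\<^sup>2 * (x \<bullet> x)"] show ?thesis by (simp add: algebra_simps)
  qed
  finally have "(2 * q - 1) * (r \<bullet> r) \<le> (2 * q - 1) * (q * (2 * (l \<bullet> l) + \<alpha>\<^sup>2 * (x \<bullet> x)))"
    using young by (simp add: algebra_simps)
  then have "r \<bullet> r \<le> q * (2 * (l \<bullet> l) + \<alpha>\<^sup>2 * (x \<bullet> x))" using q by (simp add: mult_le_cancel_left)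
  then have "\<alpha>\<^sup>2 * (1 / M\<^sup>2 * (r \<bullet> r)) \<le> 2 * (l \<bullet> l) + \<alpha>\<^sup>2 * (x \<bullet> x)"
    unfolding Mq using q \<alpha>(1) by (simp add: field_simps)
  then have "\<alpha>\<^sup>2 / 2 * (x \<bullet> x + 1 / M\<^sup>2 * (r \<bullet> r)) \<le> l \<bullet> l + \<alpha>\<^sup>2 * (x \<bullet> x)"
    by (simp add: distrib_left)
  then show ?thesis using main by (simp add: power2_norm_eq_inner)
qed

text \<open>
  With \<open>e = a - \<alpha> x\<close> the left-hand side equals \<open>|r|\<^sup>2 + 2 r \<bullet> e + |a|\<^sup>2\<close>, and \<open>e\<close> is small when \<open>M\<close> is
  close to \<open>\<alpha>\<close>. Bounding \<open>|r + a|\<close> and \<open>r \<bullet> x\<close> separately would give the constant \<open>3 M\<^sup>2\<close>, which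
  exceeds the one below for \<open>M\<close> close to \<open>\<alpha>\<close>.
\<close>

lemma residual_density_upper:
  fixes r a x :: "'a::real_inner"
  assumes \<alpha>: "0 < \<alpha>" "\<alpha> \<le> M" and coer: "a \<bullet> x \<ge> \<alpha> * (norm x)\<^sup>2" and bd: "norm a \<le> M * norm x"
  shows "(norm (r + a))\<^sup>2 - 2 * \<alpha> * (r \<bullet> x) \<le> 3 / 2 * (M ^ 4 / \<alpha>\<^sup>2) * ((norm x)\<^sup>2 + 1 / M\<^sup>2 * (norm r)\<^sup>2)"
proof -
  define q where "q = M\<^sup>2 / \<alpha>\<^sup>2"
  have q: "q \<ge> 1" unfolding q_def using \<alpha> by (simp add: divide_simps power_mono)
  define e where "e = a - \<alpha> *\<^sub>R x"
  have aM: "a \<bullet> a \<le> M\<^sup>2 * (x \<bullet> x)"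
    using power_mono[OF bd, of 2] by (simp add: power2_norm_eq_inner power_mult_distrib)
  have Mq: "M\<^sup>2 = q * \<alpha>\<^sup>2" unfolding q_def using \<alpha> by simp
  have e: "e \<bullet> e \<le> (q - 1) * (\<alpha>\<^sup>2 * (x \<bullet> x))"
    using coercive_shift_bound[OF \<alpha>(1) coer bd] unfolding e_def Mq by (simp add: algebra_simps)
  \<comment> \<open>The weight \<open>q / 2\<close> leaves \<open>1 + q / 2 \<le> 3 q / 2\<close> for \<open>r\<close>.\<close>
  have young: "q * (2 * (r \<bullet> e)) \<le> q * (q / 2 * (r \<bullet> r)) + 2 * (e \<bullet> e)"
  proof -
    have "0 \<le> ((q / 2) *\<^sub>R r - e) \<bullet> ((q / 2) *\<^sub>R r - e)" by simp
    then show ?thesis by (simp add: algebra_simps inner_commute)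
  qed
  have poly: "q * q + 2 * (q - 1) \<le> q * (3 / 2 * q\<^sup>2)"
  proof -
    have "0 \<le> 3 * q\<^sup>2 + q - 3" using q one_le_power[OF q, of 2] by linarith
    then have "0 \<le> (q - 1) * (3 * q\<^sup>2 + q - 3) + 1"
      using q by (intro add_nonneg_nonneg mult_nonneg_nonneg) auto
    then show ?thesis by (simp add: algebra_simps power2_eq_square)
  qed
  have eq: "(norm (r + a))\<^sup>2 - 2 * \<alpha> * (r \<bullet> x) = r \<bullet> r + 2 * (r \<bullet> e) + a \<bullet> a"
    unfolding e_def power2_norm_eq_inner by (simp add: algebra_simps inner_commute)
  have "q * (r \<bullet> r + 2 * (r \<bullet> e) + a \<bullet> a)
      \<le> q * (r \<bullet> r) + q * (q / 2 * (r \<bullet> r)) + (q * q + 2 * (q - 1)) * (\<alpha>\<^sup>2 * (x \<bullet> x))"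
  proof -
    have "q * (a \<bullet> a) \<le> q * (q * \<alpha>\<^sup>2 * (x \<bullet> x))" using aM q unfolding Mq by (intro mult_left_mono) auto
    then show ?thesis using young e by (simp add: algebra_simps)
  qed
  also have "\<dots> \<le> q * (3 / 2 * q * (r \<bullet> r)) + q * (3 / 2 * q\<^sup>2) * (\<alpha>\<^sup>2 * (x \<bullet> x))"
  proof (intro add_mono mult_right_mono poly)
    have "1 * (r \<bullet> r) \<le> q * (r \<bullet> r)" using q by (intro mult_right_mono) auto
    then have "r \<bullet> r + q / 2 * (r \<bullet> r) \<le> 3 / 2 * q * (r \<bullet> r)" by (simp add: algebra_simps)
    from mult_left_mono[OF this, of q] q
    show "q * (r \<bullet> r) + q * (q / 2 * (r \<bullet> r)) \<le> q * (3 / 2 * q * (r \<bullet> r))" by (simp add: algebra_simps)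
  qed auto
  finally have "q * (r \<bullet> r + 2 * (r \<bullet> e) + a \<bullet> a) \<le> q * (3 / 2 * q * (r \<bullet> r) + 3 / 2 * q\<^sup>2 * (\<alpha>\<^sup>2 * (x \<bullet> x)))"
    by (simp add: algebra_simps)
  then have "r \<bullet> r + 2 * (r \<bullet> e) + a \<bullet> a \<le> 3 / 2 * q * (r \<bullet> r) + 3 / 2 * q\<^sup>2 * (\<alpha>\<^sup>2 * (x \<bullet> x))"
    using q by (simp add: mult_le_cancel_left)
  moreover have "3 / 2 * (M ^ 4 / \<alpha>\<^sup>2) * (x \<bullet> x + 1 / M\<^sup>2 * (r \<bullet> r)) = 3 / 2 * q * (r \<bullet> r) + 3 / 2 * q\<^sup>2 * (\<alpha>\<^sup>2 * (x \<bullet> x))"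
  proof -
    have "M ^ 4 = M\<^sup>2 * M\<^sup>2" by simp
    then show ?thesis unfolding Mq using q \<alpha>(1) by (simp add: field_simps power2_eq_square)
  qed
  ultimately show ?thesis unfolding eq unfolding power2_norm_eq_inner by (simp only:)
qed


section \<open>Finite-dimensional subspaces of a real inner product space\<close>

lemma finite_span_orthonormal_basis:
  fixes Vh :: "'a::real_inner set"
  assumes "finite B" "Vh = span B"
  obtains E where "finite E" "E \<subseteq> Vh" "span E = Vh"
    "\<And>e e'. e \<in> E \<Longrightarrow> e' \<in> E \<Longrightarrow> e \<bullet> e' = (if e = e' then 1 else 0)"
proof -
  obtain C where C: "finite C" "span C = Vh" "pairwise orthogonal C"
    using basis_orthogonal[OF assms(1)] assms(2) by blast
  define E where "E = (\<lambda>c. c /\<^sub>R norm c) ` (C - {0})"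
  have fin: "finite E" unfolding E_def using C by simp
  have sub: "E \<subseteq> Vh" unfolding E_def C(2)[symmetric] by (blast intro: span_mul span_base)
  have "C \<subseteq> span E"
  proof
    fix c assume c: "c \<in> C"
    show "c \<in> span E"
    proof (cases "c = 0")
      case False
      then have "c /\<^sub>R norm c \<in> E" unfolding E_def using c by blast
      then have "norm c *\<^sub>R (c /\<^sub>R norm c) \<in> span E" by (intro span_mul span_base)
      then show ?thesis using False by simp
    qed (simp add: span_zero)
  qed
  then have sp: "span E = Vh" using sub C(2)
    by (metis span_minimal subspace_span subset_antisym)
  have on: "e \<bullet> e' = (if e = e' then 1 else 0)" if ee: "e \<in> E" "e' \<in> E" for e e'
  proof -
    obtain c c' where c: "c \<in> C" "c \<noteq> 0" "e = c /\<^sub>R norm c" and c': "c' \<in> C" "c' \<noteq> 0" "e' = c' /\<^sub>R norm c'"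
      using ee unfolding E_def by blast
    show ?thesis
    proof (cases "c = c'")
      case True
      then show ?thesis using c c' by (simp add: power2_norm_eq_inner[symmetric] power2_eq_square)
    next
      case False
      then have "c \<bullet> c' = 0" using C(3) c c' by (auto simp: pairwise_def orthogonal_def)
      then have 0: "e \<bullet> e' = 0" using c c' by simp
      have "e \<bullet> e = 1" using c by (simp add: power2_norm_eq_inner[symmetric] power2_eq_square)
      then show ?thesis using 0 by auto
    qed
  qed
  show ?thesis by (rule that[OF fin sub sp on])
qed

lemma orthonormal_expansion:
  fixes E :: "'a::real_inner set"
  assumes fin: "finite E" and on: "\<And>e e'. e \<in> E \<Longrightarrow> e' \<in> E \<Longrightarrow> e \<bullet> e' = (if e = e' then 1 else 0)"
    and v: "v \<in> span E"
  shows "v = (\<Sum>e\<in>E. (v \<bullet> e) *\<^sub>R e)"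
proof -
  obtain c where c: "v = (\<Sum>e\<in>E. c e *\<^sub>R e)" using v fin by (auto simp: span_finite)
  have "v \<bullet> e = c e" if "e \<in> E" for e
  proof -
    have "v \<bullet> e = (\<Sum>e'\<in>E. c e' * (e' \<bullet> e))" unfolding c by (simp add: inner_sum_left)
    also have "\<dots> = (\<Sum>e'\<in>E. if e' = e then c e' else 0)" by (rule sum.cong) (use on that in auto)
    finally show ?thesis using fin that by simp
  qed
  then have "(\<Sum>e\<in>E. (v \<bullet> e) *\<^sub>R e) = (\<Sum>e\<in>E. c e *\<^sub>R e)" by (intro sum.cong) auto
  then show ?thesis using c by simp
qed

text \<open>
  The Riesz representative on the span is given by its coordinates in the orthonormal basis, so its
  dependence on time is governed by the values of the functional on finitely many vectors.
\<close>

lemma riesz_span: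
  fixes E :: "'a::real_inner set"
  assumes fin: "finite E" and on: "\<And>e e'. e \<in> E \<Longrightarrow> e' \<in> E \<Longrightarrow> e \<bullet> e' = (if e = e' then 1 else 0)"
    and "linear \<phi>" and v: "v \<in> span E"
  shows "\<phi> v = (\<Sum>e\<in>E. \<phi> e *\<^sub>R e) \<bullet> v"
proof -
  interpret linear \<phi> by fact
  have "\<phi> v = \<phi> (\<Sum>e\<in>E. (v \<bullet> e) *\<^sub>R e)" using orthonormal_expansion[OF fin on v] by simp
  also have "\<dots> = (\<Sum>e\<in>E. (v \<bullet> e) * \<phi> e)" by (simp add: sum scale)
  also have "\<dots> = (\<Sum>e\<in>E. \<phi> e *\<^sub>R e) \<bullet> v"
    by (simp add: inner_sum_left inner_commute[of v] mult.commute)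
  finally show ?thesis .
qed

text \<open>
  The supremum is attained at the representative itself; for \<open>r = 0\<close> the quotient there
  is \<open>0 / 0 = 0\<close>, which is the right value.
\<close>

lemma dual_norm_riesz:
  assumes r: "r \<in> Vh" and rep: "\<And>v. v \<in> Vh \<Longrightarrow> \<phi> v = r \<bullet> v"
  shows "dual_norm Vh \<phi> = norm r"
  unfolding dual_norm_def
proof (rule cSup_eq_maximum)
  show "norm r \<in> (\<lambda>v. \<phi> v / norm v) ` Vh"
    by (rule image_eqI[of _ _ r]) (auto simp: r rep power2_norm_eq_inner[symmetric] power2_eq_square)
next
  fix y assume "y \<in> (\<lambda>v. \<phi> v / norm v) ` Vh"
  then obtain v where v: "v \<in> Vh" "y = (r \<bullet> v) / norm v" using rep by auto
  show "y \<le> norm r"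
    unfolding v(2) using Cauchy_Schwarz_ineq2[of r v] by (auto simp: divide_le_eq split: if_splits)
qed


section \<open>Square-integrable functions on the interval\<close>

lemma finite_measure_meas_I: "finite_measure (meas_I T)"
  by (rule finite_measure_lebesgue_on) (rule lmeasurable_box[of "0::real" T, simplified box_real])

lemma meas_I_subset_null:
  assumes "Z \<in> null_sets (meas_I T)" "A \<subseteq> Z"
  shows "A \<in> sets (meas_I T)"
proof -
  have S: "{0<..<T} \<in> sets lebesgue" by simp
  have "Z \<in> null_sets lebesgue" and "Z \<subseteq> {0<..<T}"
    using assms(1) null_sets_restrict_space[OF S] by auto
  then have "A \<in> null_sets lebesgue" "A \<subseteq> {0<..<T}"
    using assms(2) by (auto intro: null_sets_completion_subset)
  then have "A \<in> null_sets (meas_I T)" using null_sets_restrict_space[OF S] by simp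
  then show ?thesis by auto
qed

text \<open>
  This is completeness of Lebesgue measure: preimages under \<open>f\<close> and \<open>g\<close> differ by a subset of a
  null set.
\<close>

lemma borel_measurable_meas_I_AE:
  fixes f g :: "real \<Rightarrow> 'b::topological_space"
  assumes f: "f \<in> borel_measurable (meas_I T)" and eq: "AE t in meas_I T. f t = g t"
  shows "g \<in> borel_measurable (meas_I T)"
proof -
  obtain Z where Z: "Z \<in> null_sets (meas_I T)" "{t \<in> space (meas_I T). f t \<noteq> g t} \<subseteq> Z"
    using eq by (auto simp: eventually_ae_filter)
  show ?thesis
  proof (rule borel_measurableI)
    fix S :: "'b set" assume "open S"
    then have [measurable]: "S \<in> sets borel" by simp
    have "f -` S \<inter> space (meas_I T) - Z \<in> sets (meas_I T)"
      using measurable_sets[OF f, of S] Z(1) by (intro sets.Diff) auto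
    moreover have "g -` S \<inter> space (meas_I T) \<inter> Z \<in> sets (meas_I T)"
      using meas_I_subset_null[OF Z(1)] by blast
    moreover have "g -` S \<inter> space (meas_I T) =
        (f -` S \<inter> space (meas_I T) - Z) \<union> (g -` S \<inter> space (meas_I T) \<inter> Z)"
      using Z(2) by auto
    ultimately show "g -` S \<inter> space (meas_I T) \<in> sets (meas_I T)" by (metis sets.Un)
  qed
qed

text \<open>
  The approximating simple functions converge off a null set only. Replacing them by zero on that set
  makes them converge everywhere, and the limit is an almost everywhere modification of \<open>f\<close>.
\<close>

lemma strongly_measurable_borel_measurable:
  fixes f :: "real \<Rightarrow> 'b::real_normed_vector"
  assumes "strongly_measurable (meas_I T) f"
  shows "f \<in> borel_measurable (meas_I T)"
proof -
  obtain s where s: "\<And>n. simple_function (meas_I T) (s n)"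
    and lim: "AE t in meas_I T. (\<lambda>n. s n t) \<longlonglongrightarrow> f t"
    using assms unfolding strongly_measurable_def by blast
  obtain Z where Z: "Z \<in> null_sets (meas_I T)" "{t \<in> space (meas_I T). \<not> (\<lambda>n. s n t) \<longlonglongrightarrow> f t} \<subseteq> Z"
    using lim by (auto simp: eventually_ae_filter)
  let ?u = "\<lambda>n t. indicator (- Z) t *\<^sub>R s n t"
  have sm: "?u n \<in> borel_measurable (meas_I T)" for n
  proof -
    have "simple_function (meas_I T) (indicator (space (meas_I T) - Z) :: real \<Rightarrow> real)"
      using Z(1) by auto
    from simple_function_compose2[OF this s[of n], of "(*\<^sub>R)"]
    have "(\<lambda>t. indicator (space (meas_I T) - Z) t *\<^sub>R s n t) \<in> borel_measurable (meas_I T)"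
      by (rule borel_measurable_simple_function)
    then show ?thesis
      by (rule measurable_cong[THEN iffD1, rotated]) (auto simp: indicator_def)
  qed
  have "(\<lambda>t. indicator (- Z) t *\<^sub>R f t) \<in> borel_measurable (meas_I T)"
  proof (rule borel_measurable_LIMSEQ_metric[OF sm])
    fix t assume "t \<in> space (meas_I T)"
    then show "(\<lambda>n. ?u n t) \<longlonglongrightarrow> indicator (- Z) t *\<^sub>R f t"
      using Z(2) by (cases "t \<in> Z") auto
  qed
  moreover have "AE t in meas_I T. indicator (- Z) t *\<^sub>R f t = f t"
    using AE_not_in[OF Z(1)] by eventually_elim simp
  ultimately show ?thesis by (rule borel_measurable_meas_I_AE)
qed

lemma borel_measurable_strongly_measurable:
  fixes f :: "'a \<Rightarrow> 'b::{real_normed_vector, second_countable_topology}"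
  assumes "f \<in> borel_measurable N"
  shows "strongly_measurable N f"
proof -
  obtain s where "\<forall>n. simple_function N (s n)" "\<forall>t\<in>space N. (\<lambda>n. s n t) \<longlonglongrightarrow> f t"
    using borel_measurable_implies_sequence_metric[OF assms, of 0] by blast
  then show ?thesis unfolding strongly_measurable_def by (intro exI[of _ s]) auto
qed

lemma strongly_measurable_compose:
  assumes "strongly_measurable N f" "continuous_on UNIV h"
  shows "strongly_measurable N (\<lambda>t. h (f t))"
proof -
  obtain s where s: "\<And>n. simple_function N (s n)" "AE t in N. (\<lambda>n. s n t) \<longlonglongrightarrow> f t"
    using assms unfolding strongly_measurable_def by blast
  have "simple_function N (\<lambda>t. h (s n t))" for n
    using simple_function_compose[OF s(1)[of n], of h] by (simp add: comp_def)
  moreover have "AE t in N. (\<lambda>n. h (s n t)) \<longlonglongrightarrow> h (f t)"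
    using s(2) by eventually_elim (use continuous_on_tendsto_compose[OF assms(2)] in auto)
  ultimately show ?thesis unfolding strongly_measurable_def by (intro exI[of _ "\<lambda>n t. h (s n t)"]) auto
qed

lemma L2_iff:
  fixes f :: "real \<Rightarrow> 'b::{banach, second_countable_topology}"
  shows "f \<in> L2 T \<longleftrightarrow> f \<in> borel_measurable (meas_I T) \<and> integrable (meas_I T) (\<lambda>t. (norm (f t))\<^sup>2)"
  unfolding L2_def
  using strongly_measurable_borel_measurable borel_measurable_strongly_measurable by blast

lemma L2_bound:
  fixes f :: "real \<Rightarrow> 'b::{banach, second_countable_topology}"
  assumes "f \<in> borel_measurable (meas_I T)" "g \<in> L2 T" "AE t in meas_I T. norm (f t) \<le> c * norm (g t)"
  shows "f \<in> L2 T"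
  unfolding L2_iff
proof (intro conjI assms(1))
  note [measurable] = assms(1)
  have "integrable (meas_I T) (\<lambda>t. c\<^sup>2 * (norm (g t))\<^sup>2)" using assms(2) unfolding L2_def by auto
  then show "integrable (meas_I T) (\<lambda>t. (norm (f t))\<^sup>2)"
  proof (rule Bochner_Integration.integrable_bound)
    show "AE t in meas_I T. norm ((norm (f t))\<^sup>2) \<le> norm (c\<^sup>2 * (norm (g t))\<^sup>2)"
      using assms(3)
    proof eventually_elim
      case (elim t)
      from power_mono[OF this, of 2] show ?case by (simp add: power_mult_distrib)
    qed
  qed measurable
qed

lemma L2_add:
  fixes f g :: "real \<Rightarrow> 'b::{banach, second_countable_topology}"
  assumes "f \<in> L2 T" "g \<in> L2 T"
  shows "(\<lambda>t. f t + g t) \<in> L2 T"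
  unfolding L2_iff
proof
  have [measurable]: "f \<in> borel_measurable (meas_I T)" "g \<in> borel_measurable (meas_I T)"
    using assms by (auto simp: L2_iff)
  show "(\<lambda>t. f t + g t) \<in> borel_measurable (meas_I T)" by measurable
  have "integrable (meas_I T) (\<lambda>t. 2 * (norm (f t))\<^sup>2 + 2 * (norm (g t))\<^sup>2)"
    using assms by (auto simp: L2_iff)
  then show "integrable (meas_I T) (\<lambda>t. (norm (f t + g t))\<^sup>2)"
  proof (rule Bochner_Integration.integrable_bound, goal_cases)
    case 2
    have "(norm (a + b))\<^sup>2 \<le> 2 * (norm a)\<^sup>2 + 2 * (norm b)\<^sup>2" for a b :: 'b
    proof -
      have "(norm (a + b))\<^sup>2 \<le> (norm a + norm b)\<^sup>2" by (intro power_mono norm_triangle_ineq) auto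
      moreover have "0 \<le> (norm a - norm b)\<^sup>2" by simp
      ultimately show ?thesis unfolding power2_sum power2_diff by linarith
    qed
    then show ?case by auto
  qed measurable
qed

lemma L2_bounded_linear:
  fixes f :: "real \<Rightarrow> 'b::real_normed_vector"
    and h :: "'b \<Rightarrow> 'c::{banach, second_countable_topology}"
  assumes "f \<in> L2 T" "bounded_linear h"
  shows "(\<lambda>t. h (f t)) \<in> L2 T"
proof (rule L2_bound[OF _ assms(1)])
  have "strongly_measurable (meas_I T) (\<lambda>t. h (f t))"
    by (rule strongly_measurable_compose) (use assms in \<open>auto simp: L2_def intro: linear_continuous_on\<close>)
  then show "(\<lambda>t. h (f t)) \<in> borel_measurable (meas_I T)"
    by (rule strongly_measurable_borel_measurable)
  show "AE t in meas_I T. norm (h (f t)) \<le> onorm h * norm (f t)"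
    by (intro AE_I2 onorm assms(2))
qed

lemma L2_diff:
  fixes f g :: "real \<Rightarrow> 'b::{banach, second_countable_topology}"
  assumes "f \<in> L2 T" "g \<in> L2 T"
  shows "(\<lambda>t. f t - g t) \<in> L2 T"
  using L2_add[OF assms(1) L2_bounded_linear[OF assms(2) bounded_linear_minus[OF bounded_linear_ident]]]
  by simp

lemma L2_sum:
  fixes f :: "'i \<Rightarrow> real \<Rightarrow> 'b::{banach, second_countable_topology}"
  assumes "\<And>i. i \<in> I \<Longrightarrow> f i \<in> L2 T"
  shows "(\<lambda>t. \<Sum>i\<in>I. f i t) \<in> L2 T"
  using assms
proof (induction I rule: infinite_finite_induct)
  case (insert i I)
  then show ?case using L2_add[of "f i" T "\<lambda>t. \<Sum>i\<in>I. f i t"] by simp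
next
  case empty
  show ?case by (simp add: L2_iff)
next
  case (infinite I)
  then show ?case by (simp add: L2_iff)
qed

lemma integrable_L2_norm_mult:
  fixes f :: "real \<Rightarrow> 'b::{banach, second_countable_topology}" and g :: "real \<Rightarrow> 'c::{banach, second_countable_topology}"
  assumes "f \<in> L2 T" "g \<in> L2 T"
  shows "integrable (meas_I T) (\<lambda>t. norm (f t) * norm (g t))"
proof -
  have [measurable]: "f \<in> borel_measurable (meas_I T)" "g \<in> borel_measurable (meas_I T)"
    using assms by (auto simp: L2_iff)
  have "integrable (meas_I T) (\<lambda>t. (norm (f t))\<^sup>2 + (norm (g t))\<^sup>2)"
    using assms by (auto simp: L2_iff)
  then show ?thesis
  proof (rule Bochner_Integration.integrable_bound, goal_cases)
    case 2
    have "a * b \<le> a\<^sup>2 + b\<^sup>2" for a b :: real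
      using sum_squares_bound[of a b] zero_le_power2[of a] zero_le_power2[of b] by linarith
    then show ?case by simp
  qed measurable
qed

lemma integrable_L2_inner:
  fixes f g :: "real \<Rightarrow> 'b::{banach, real_inner, second_countable_topology}"
  assumes "f \<in> L2 T" "g \<in> L2 T"
  shows "integrable (meas_I T) (\<lambda>t. f t \<bullet> g t)"
proof (rule Bochner_Integration.integrable_bound[OF integrable_L2_norm_mult[OF assms]])
  have [measurable]: "f \<in> borel_measurable (meas_I T)" "g \<in> borel_measurable (meas_I T)"
    using assms by (auto simp: L2_iff)
  show "(\<lambda>t. f t \<bullet> g t) \<in> borel_measurable (meas_I T)" by measurable
  show "AE t in meas_I T. norm (f t \<bullet> g t) \<le> norm (norm (f t) * norm (g t))"
    by (simp add: Cauchy_Schwarz_ineq2)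
qed

lemma integrable_L2:
  fixes f :: "real \<Rightarrow> 'b::{banach, second_countable_topology}"
  assumes "f \<in> L2 T"
  shows "integrable (meas_I T) f"
proof -
  interpret finite_measure "meas_I T" by (rule finite_measure_meas_I)
  have "(\<lambda>t. 1::real) \<in> L2 T" by (simp add: L2_iff)
  from integrable_L2_norm_mult[OF assms this] have "integrable (meas_I T) (\<lambda>t. norm (f t))" by simp
  then show ?thesis
    by (rule integrable_norm_cancel) (use assms L2_iff in blast)
qed


section \<open>Smoothed indicators and the fundamental theorem for weak derivatives\<close>

text \<open>
  A quadratic spline of class \<open>C\<^sup>1\<close> climbing from \<open>0\<close> to \<open>1\<close> on \<open>[0, 1]\<close>. Shifts of it give admissible
  test functions, and its derivative, the tent of unit mass below, gives an approximate identity.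
\<close>

definition ramp :: "real \<Rightarrow> real" where
  "ramp s = 2 * ((max 0 s)\<^sup>2 - 2 * (max 0 (s - 1/2))\<^sup>2 + (max 0 (s - 1))\<^sup>2)"

definition hat :: "real \<Rightarrow> real" where
  "hat s = 4 * (max 0 s - 2 * max 0 (s - 1/2) + max 0 (s - 1))"

lemma has_real_derivative_max_0_square:
  "((\<lambda>s::real. (max 0 s)\<^sup>2) has_real_derivative 2 * max 0 s) (at s)"
proof (cases s "0::real" rule: linorder_cases)
  case less
  have "((\<lambda>s::real. 0) has_real_derivative 0) (at s)" by simp
  from has_field_derivative_transform_within_open[OF this, of "{..<0}" "\<lambda>s. (max 0 s)\<^sup>2"] show ?thesis
    using less by simp
next
  case equal
  have "((\<lambda>s::real. (max 0 s)\<^sup>2 / s) \<longlongrightarrow> 0) (at 0)"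
  proof (rule tendsto_0_le[where f="\<lambda>s. s" and K=1])
    show "\<forall>\<^sub>F s in at 0. norm ((max 0 s)\<^sup>2 / s :: real) \<le> norm s * 1"
      by (rule always_eventually) (auto simp: max_def power2_eq_square)
  qed (rule tendsto_ident_at)
  then show ?thesis using equal by (simp add: has_field_derivative_iff)
next
  case greater
  have "((\<lambda>s::real. s\<^sup>2) has_real_derivative 2 * s) (at s)" by (auto intro!: derivative_eq_intros)
  from has_field_derivative_transform_within_open[OF this, of "{0<..}" "\<lambda>s. (max 0 s)\<^sup>2"] show ?thesis
    using greater by simp
qed

lemma ramp_deriv: "(ramp has_real_derivative hat s) (at s)"
proof -
  have sh: "((\<lambda>s. (max 0 (s - c))\<^sup>2) has_real_derivative 2 * max 0 (s - c)) (at s)" for c :: real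
    using DERIV_chain2[where f="\<lambda>s. (max 0 s)\<^sup>2" and g="\<lambda>s. s - c" and x=s and s=UNIV,
        OF has_real_derivative_max_0_square DERIV_diff[OF DERIV_ident DERIV_const]] by simp
  show ?thesis
    unfolding ramp_def[abs_def] hat_def
    by (rule derivative_eq_intros has_real_derivative_max_0_square sh refl)+ simp
qed

lemma hat_nonneg: "0 \<le> hat s" and hat_le: "hat s \<le> 4" and hat_eq_0: "s \<le> 0 \<or> 1 \<le> s \<Longrightarrow> hat s = 0"
  unfolding hat_def max_def by auto

lemma continuous_on_hat: "continuous_on S hat"
  unfolding hat_def[abs_def] by (intro continuous_intros)

lemma ramp_eq_0: "s \<le> 0 \<Longrightarrow> ramp s = 0" and ramp_eq_1: "1 \<le> s \<Longrightarrow> ramp s = 1"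
  unfolding ramp_def max_def by (auto simp: power2_eq_square algebra_simps)

lemma ramp_mono: "s \<le> t \<Longrightarrow> ramp s \<le> ramp t"
  by (rule DERIV_nonneg_imp_nondecreasing) (use ramp_deriv hat_nonneg in blast)+

lemma ramp_bounds: "0 \<le> ramp s" "ramp s \<le> 1"
  using ramp_mono[of "min s 0" s] ramp_mono[of s "max s 1"] ramp_eq_0[of "min s 0"] ramp_eq_1[of "max s 1"]
  by auto

lemma ramp_scaled_deriv:
  "((\<lambda>t. ramp ((t - p) / \<delta>)) has_real_derivative hat ((t - p) / \<delta>) / \<delta>) (at t)"
proof -
  have "((\<lambda>t. (t - p) / \<delta>) has_real_derivative 1 / \<delta>) (at t)"
    by (cases "\<delta> = 0") (auto intro!: derivative_eq_intros)
  from DERIV_chain2[where f=ramp, OF ramp_deriv this] show ?thesis by simp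
qed

lemma borel_measurable_meas_I_continuous:
  "continuous_on UNIV f \<Longrightarrow> f \<in> borel_measurable (meas_I T)"
  by (intro measurable_restrict_space1 measurable_completion) (simp add: borel_measurable_continuous_onI)

lemma hat_scaled:
  assumes "0 < p" "0 < \<delta>" "p + \<delta> < T"
  shows "integrable (meas_I T) (\<lambda>t. hat ((t - p) / \<delta>) / \<delta>)"
    and "(LINT t|meas_I T. hat ((t - p) / \<delta>) / \<delta>) = 1"
proof -
  interpret finite_measure "meas_I T" by (rule finite_measure_meas_I)
  have m: "(\<lambda>t. hat ((t - p) / \<delta>) / \<delta>) \<in> borel_measurable (meas_I T)"
    using assms by (intro borel_measurable_meas_I_continuous continuous_intros
        continuous_on_compose2[OF continuous_on_hat[of UNIV]]) auto
  show int: "integrable (meas_I T) (\<lambda>t. hat ((t - p) / \<delta>) / \<delta>)"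
  proof (rule integrable_const_bound[OF _ m, of "4 / \<delta>"])
    show "AE t in meas_I T. norm (hat ((t - p) / \<delta>) / \<delta>) \<le> 4 / \<delta>"
      using assms hat_nonneg hat_le by (intro AE_I2) (auto intro!: divide_right_mono)
  qed
  have "((\<lambda>t. hat ((t - p) / \<delta>) / \<delta>) has_integral ramp ((T - p) / \<delta>) - ramp ((0 - p) / \<delta>)) {0..T}"
    using assms ramp_scaled_deriv
    by (intro fundamental_theorem_of_calculus)
      (auto simp: has_real_derivative_iff_has_vector_derivative[symmetric] intro: has_field_derivative_at_within)
  moreover have "ramp ((T - p) / \<delta>) - ramp ((0 - p) / \<delta>) = 1"
    using assms by (subst ramp_eq_0, simp, subst ramp_eq_1) (auto simp: divide_simps)
  ultimately have "integral {0<..<T} (\<lambda>t. hat ((t - p) / \<delta>) / \<delta>) = 1"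
    unfolding integral_open_interval_real[symmetric] by (metis integral_unique)
  moreover have "(LINT t|meas_I T. hat ((t - p) / \<delta>) / \<delta>) = integral {0<..<T} (\<lambda>t. hat ((t - p) / \<delta>) / \<delta>)"
    by (rule lebesgue_integral_eq_integral[OF int]) simp
  ultimately show "(LINT t|meas_I T. hat ((t - p) / \<delta>) / \<delta>) = 1" by (simp only:)
qed

lemma integrable_bounded_scaleR_L2:
  fixes x :: "real \<Rightarrow> 'b::{banach, second_countable_topology}"
  assumes "x \<in> L2 T" and [measurable]: "\<psi> \<in> borel_measurable (meas_I T)"
    and "\<And>t. t \<in> {0<..<T} \<Longrightarrow> \<bar>\<psi> t\<bar> \<le> c"
  shows "integrable (meas_I T) (\<lambda>t. \<psi> t *\<^sub>R x t)"
proof (rule Bochner_Integration.integrable_bound[of _ "\<lambda>t. c *\<^sub>R x t"])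
  have [measurable]: "x \<in> borel_measurable (meas_I T)" using assms L2_iff by blast
  show "(\<lambda>t. \<psi> t *\<^sub>R x t) \<in> borel_measurable (meas_I T)" by measurable
  show "AE t in meas_I T. norm (\<psi> t *\<^sub>R x t) \<le> norm (c *\<^sub>R x t)"
  proof (rule AE_I2)
    fix t assume "t \<in> space (meas_I T)"
    then have "\<bar>\<psi> t\<bar> \<le> \<bar>c\<bar>" using assms(3)[of t] by simp
    then show "norm (\<psi> t *\<^sub>R x t) \<le> norm (c *\<^sub>R x t)" by (simp add: mult_right_mono)
  qed
qed (use integrable_L2[OF assms(1)] in simp)

text \<open>
  A kernel of unit mass, concentrated on an interval that shrinks to \<open>c\<close>, picks out the value
  at \<open>c\<close> of a continuous function. The intervals lie in \<open>(0, T)\<close>, so that the end points \<open>0\<close> and \<open>T\<close>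
  are allowed for \<open>c\<close>.
\<close>

lemma hat_mollifier_tendsto:
  fixes x :: "real \<Rightarrow> 'b::{banach, second_countable_topology}"
  assumes x: "x \<in> L2 T" "continuous_on {0..T} x" and c: "c \<in> {0..T}"
    and p: "\<And>n. 0 < p n" "\<And>n. 0 < \<delta> n" "\<And>n. p n + \<delta> n < T"
    and lim: "p \<longlonglongrightarrow> c" "\<delta> \<longlonglongrightarrow> 0"
  shows "(\<lambda>n. LINT t|meas_I T. (hat ((t - p n) / \<delta> n) / \<delta> n) *\<^sub>R x t) \<longlonglongrightarrow> x c"
proof (rule tendstoI)
  fix \<epsilon> :: real assume "\<epsilon> > 0"
  then obtain d where d: "d > 0" "\<And>t. t \<in> {0..T} \<Longrightarrow> dist t c < d \<Longrightarrow> dist (x t) (x c) < \<epsilon> / 2"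
    using x(2) c unfolding continuous_on_iff by (metis half_gt_zero)
  have "\<forall>\<^sub>F n in sequentially. dist (p n) c < d / 2" "\<forall>\<^sub>F n in sequentially. dist (\<delta> n) 0 < d / 2"
    using tendstoD[OF lim(1), of "d / 2"] tendstoD[OF lim(2), of "d / 2"] d(1) by auto
  then show "\<forall>\<^sub>F n in sequentially. dist (LINT t|meas_I T. (hat ((t - p n) / \<delta> n) / \<delta> n) *\<^sub>R x t) (x c) < \<epsilon>"
  proof eventually_elim
    case (elim n)
    let ?\<rho> = "\<lambda>t. hat ((t - p n) / \<delta> n) / \<delta> n"
    note \<rho> = hat_scaled[OF p[of n]]
    have nn: "0 \<le> ?\<rho> t" for t using hat_nonneg p(2)[of n] by simp
    have int1: "integrable (meas_I T) (\<lambda>t. ?\<rho> t *\<^sub>R x t)"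
      using \<rho>(1) p(2)[of n] hat_le hat_nonneg nn
      by (intro integrable_bounded_scaleR_L2[OF x(1), of _ "4 / \<delta> n"]) (auto intro!: divide_right_mono)
    have int2: "integrable (meas_I T) (\<lambda>t. ?\<rho> t *\<^sub>R x c)" using \<rho>(1) by simp
    have "(LINT t|meas_I T. ?\<rho> t *\<^sub>R x t) - x c = (LINT t|meas_I T. ?\<rho> t *\<^sub>R x t) - (LINT t|meas_I T. ?\<rho> t *\<^sub>R x c)"
      using \<rho> by simp
    also have "\<dots> = (LINT t|meas_I T. ?\<rho> t *\<^sub>R (x t - x c))"
      using Bochner_Integration.integral_diff[OF int1 int2] by (simp add: scaleR_diff_right)
    finally have eq: "(LINT t|meas_I T. ?\<rho> t *\<^sub>R x t) - x c = (LINT t|meas_I T. ?\<rho> t *\<^sub>R (x t - x c))" .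
    have int3: "integrable (meas_I T) (\<lambda>t. ?\<rho> t *\<^sub>R (x t - x c))"
      using Bochner_Integration.integrable_diff[OF int1 int2] by (simp add: scaleR_diff_right)
    have "norm (LINT t|meas_I T. ?\<rho> t *\<^sub>R (x t - x c)) \<le> (LINT t|meas_I T. norm (?\<rho> t *\<^sub>R (x t - x c)))"
      by (rule integral_norm_bound)
    also have "\<dots> \<le> (LINT t|meas_I T. ?\<rho> t * (\<epsilon> / 2))"
    proof (rule integral_mono)
      show "integrable (meas_I T) (\<lambda>t. norm (?\<rho> t *\<^sub>R (x t - x c)))" using int3 by (rule integrable_norm)
      show "integrable (meas_I T) (\<lambda>t. ?\<rho> t * (\<epsilon> / 2))" using \<rho>(1) by (rule integrable_mult_left)
      fix t assume t: "t \<in> space (meas_I T)"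
      show "norm (?\<rho> t *\<^sub>R (x t - x c)) \<le> ?\<rho> t * (\<epsilon> / 2)"
      proof (cases "p n < t \<and> t < p n + \<delta> n")
        case True
        then have "dist t c < d" using elim unfolding dist_real_def by linarith
        then have "norm (x t - x c) \<le> \<epsilon> / 2" using d(2)[of t] t by (simp add: dist_norm)
        then have "?\<rho> t * norm (x t - x c) \<le> ?\<rho> t * (\<epsilon> / 2)" by (intro mult_left_mono nn)
        then show ?thesis unfolding norm_scaleR abs_of_nonneg[OF nn] .
      next
        case False
        then have "?\<rho> t = 0" using p(2)[of n] by (subst hat_eq_0) (auto simp: divide_simps)
        then show ?thesis by (simp only: scaleR_zero_left norm_zero mult_zero_left order_refl)
      qed
    qed
    also have "\<dots> = \<epsilon> / 2" using \<rho> by simp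
    finally show ?case using \<open>\<epsilon> > 0\<close> unfolding dist_norm eq by linarith
  qed
qed

text \<open>
  Test with functions that increase from \<open>0\<close> to \<open>1\<close> just after \<open>0\<close> and decrease to \<open>0\<close> just
  before \<open>b\<close>. Their derivatives are two opposite approximate identities, producing \<open>x 0 - x b\<close>, while
  the functions themselves converge boundedly to the indicator of \<open>(0, b)\<close>.
\<close>

lemma weak_deriv_integral:
  fixes x g :: "real \<Rightarrow> 'b::{banach, second_countable_topology}"
  assumes x: "x \<in> L2 T" "continuous_on {0..T} x" and g: "g \<in> L2 T" and wd: "has_weak_deriv T x g"
    and b: "b \<in> {0..T}"
  shows "x b = x 0 + (LINT t|meas_I T. indicator {..<b} t *\<^sub>R g t)"
proof (cases "b = 0")
  case True
  have "(LINT t|meas_I T. indicator {..<b} t *\<^sub>R g t) = (LINT t|meas_I T. 0)"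
    by (rule Bochner_Integration.integral_cong) (use True in auto)
  then show ?thesis using True by simp
next
  case False
  then have b0: "0 < b" "b \<le> T" using b by auto
  \<comment> \<open>The denominator \<open>n + 4\<close> keeps the two flanks, \<open>[\<delta>, 2 \<delta>]\<close> and \<open>[b - 2 \<delta>, b - \<delta>]\<close>, apart.\<close>
  define \<delta> where "\<delta> n = b / (real n + 4)" for n :: nat
  have \<delta>: "0 < \<delta> n" "4 * \<delta> n \<le> b" for n
    using b0 unfolding \<delta>_def by (auto simp: field_simps)
  have \<delta>0: "\<delta> \<longlonglongrightarrow> 0" unfolding \<delta>_def
    by (rule real_tendsto_divide_at_top[OF tendsto_const]) (rule filterlim_tendsto_add_at_top[OF tendsto_const filterlim_real_sequentially, of 4, unfolded add.commute[of 4]])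
  define \<phi> where "\<phi> n t = ramp ((t - \<delta> n) / \<delta> n) - ramp ((t - (b - 2 * \<delta> n)) / \<delta> n)" for n t
  define \<psi> where "\<psi> n t = hat ((t - \<delta> n) / \<delta> n) / \<delta> n - hat ((t - (b - 2 * \<delta> n)) / \<delta> n) / \<delta> n" for n t
  have deriv: "(\<phi> n has_real_derivative \<psi> n t) (at t)" for n t
    unfolding \<phi>_def[abs_def] \<psi>_def by (intro DERIV_diff ramp_scaled_deriv)
  have cont\<phi>: "continuous_on UNIV (\<phi> n)" for n
    using deriv by (meson DERIV_continuous continuous_at_imp_continuous_on)
  have cont\<psi>: "continuous_on UNIV (\<psi> n)" for n
    unfolding \<psi>_def[abs_def] using \<delta>(1)[of n]
    by (intro continuous_intros continuous_on_compose2[OF continuous_on_hat[of UNIV]]) auto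
  have test: "test_fun T (\<phi> n)" for n
    unfolding test_fun_def C1_differentiable_on_def
  proof (intro conjI exI)
    show "\<forall>t\<in>UNIV. (\<phi> n has_vector_derivative \<psi> n t) (at t)"
      using deriv by (simp add: has_real_derivative_iff_has_vector_derivative)
    show "continuous_on UNIV (\<psi> n)" by (rule cont\<psi>)
    show "0 < \<delta> n" "b - \<delta> n < T" using \<delta>[of n] b0 by auto
    show "\<forall>t. t \<notin> {\<delta> n..b - \<delta> n} \<longrightarrow> \<phi> n t = 0"
    proof (intro allI impI)
      fix t assume "t \<notin> {\<delta> n..b - \<delta> n}"
      then consider "t < \<delta> n" | "t > b - \<delta> n" by force
      then show "\<phi> n t = 0"
      proof cases
        case 1
        then show ?thesis unfolding \<phi>_def using \<delta>[of n]
          by (subst (1 2) ramp_eq_0) (auto simp: divide_simps)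
      next
        case 2
        then show ?thesis unfolding \<phi>_def using \<delta>[of n]
          by (subst (1 2) ramp_eq_1) (auto simp: divide_simps)
      qed
    qed
  qed
  have eq: "(LINT t|meas_I T. \<psi> n t *\<^sub>R x t) = - (LINT t|meas_I T. \<phi> n t *\<^sub>R g t)" for n
  proof -
    have "deriv (\<phi> n) = \<psi> n" using deriv DERIV_imp_deriv by blast
    then show ?thesis using wd test[of n] unfolding has_weak_deriv_def by metis
  qed
  have lim1: "(\<lambda>n. LINT t|meas_I T. \<psi> n t *\<^sub>R x t) \<longlonglongrightarrow> x 0 - x b"
  proof -
    have int: "integrable (meas_I T) (\<lambda>t. (hat ((t - p) / \<delta> n) / \<delta> n) *\<^sub>R x t)"
      if "0 < p" "p + \<delta> n < T" for p n
      using hat_scaled(1)[OF that(1) \<delta>(1) that(2)] \<delta>(1)[of n] hat_le hat_nonneg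
      by (intro integrable_bounded_scaleR_L2[OF x(1), of _ "4 / \<delta> n"]) (auto intro!: divide_right_mono)
    have "(LINT t|meas_I T. \<psi> n t *\<^sub>R x t) =
        (LINT t|meas_I T. (hat ((t - \<delta> n) / \<delta> n) / \<delta> n) *\<^sub>R x t)
        - (LINT t|meas_I T. (hat ((t - (b - 2 * \<delta> n)) / \<delta> n) / \<delta> n) *\<^sub>R x t)" for n
      unfolding \<psi>_def scaleR_diff_left
      using \<delta>[of n] b0 by (intro Bochner_Integration.integral_diff int) auto
    moreover have "(\<lambda>n. LINT t|meas_I T. (hat ((t - \<delta> n) / \<delta> n) / \<delta> n) *\<^sub>R x t) \<longlonglongrightarrow> x 0"
    proof (rule hat_mollifier_tendsto[OF x])
      show "\<delta> n + \<delta> n < T" for n using \<delta>[of n] b0 by auto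
    qed (use b0 \<delta> \<delta>0 in auto)
    moreover have "(\<lambda>n. LINT t|meas_I T. (hat ((t - (b - 2 * \<delta> n)) / \<delta> n) / \<delta> n) *\<^sub>R x t) \<longlonglongrightarrow> x b"
    proof (rule hat_mollifier_tendsto[OF x])
      show "0 < b - 2 * \<delta> n" "b - 2 * \<delta> n + \<delta> n < T" for n using \<delta>[of n] b0 by auto
      have "(\<lambda>n. b - 2 * \<delta> n) \<longlonglongrightarrow> b - 2 * 0" by (intro tendsto_intros \<delta>0)
      then show "(\<lambda>n. b - 2 * \<delta> n) \<longlonglongrightarrow> b" by simp
    qed (use b0 \<delta> \<delta>0 in auto)
    ultimately show ?thesis by (simp add: tendsto_diff)
  qed
  have lim2: "(\<lambda>n. LINT t|meas_I T. \<phi> n t *\<^sub>R g t) \<longlonglongrightarrow> (LINT t|meas_I T. indicator {..<b} t *\<^sub>R g t)"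
  proof (rule integral_dominated_convergence[where w="\<lambda>t. norm (g t)"])
    have [measurable]: "g \<in> borel_measurable (meas_I T)" using g L2_iff by blast
    have [measurable]: "\<phi> n \<in> borel_measurable (meas_I T)" for n
      by (rule borel_measurable_meas_I_continuous[OF cont\<phi>])
    show "(\<lambda>t. \<phi> n t *\<^sub>R g t) \<in> borel_measurable (meas_I T)" for n by measurable
    have "(\<lambda>t. indicator {..<b} t :: real) \<in> borel_measurable (meas_I T)"
      by (intro measurable_restrict_space1 measurable_completion) simp
    then show "(\<lambda>t. indicator {..<b} t *\<^sub>R g t) \<in> borel_measurable (meas_I T)" by measurable
    show "integrable (meas_I T) (\<lambda>t. norm (g t))" using integrable_L2[OF g] by simp
    show "AE t in meas_I T. norm (\<phi> n t *\<^sub>R g t) \<le> norm (g t)" for n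
    proof (rule AE_I2)
      fix t
      have "\<bar>\<phi> n t\<bar> \<le> 1" unfolding \<phi>_def
        using ramp_bounds[of "(t - \<delta> n) / \<delta> n"] ramp_bounds[of "(t - (b - 2 * \<delta> n)) / \<delta> n"] by linarith
      then show "norm (\<phi> n t *\<^sub>R g t) \<le> norm (g t)" using mult_right_mono[of _ 1 "norm (g t)"] by simp
    qed
    show "AE t in meas_I T. (\<lambda>n. \<phi> n t *\<^sub>R g t) \<longlonglongrightarrow> indicator {..<b} t *\<^sub>R g t"
    proof (rule AE_I2)
      fix t assume t: "t \<in> space (meas_I T)"
      have "\<forall>\<^sub>F n in sequentially. \<phi> n t = indicator {..<b} t"
      proof (cases "t < b")
        case True
        then have "0 < min (t / 2) ((b - t) / 2)" using t by simp
        from tendstoD[OF \<delta>0 this] show ?thesis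
        proof eventually_elim
          case (elim n)
          then have "2 * \<delta> n \<le> t" "2 * \<delta> n \<le> b - t" using \<delta>[of n] by (auto simp: dist_real_def)
          then have "ramp ((t - \<delta> n) / \<delta> n) = 1" "ramp ((t - (b - 2 * \<delta> n)) / \<delta> n) = 0"
            using \<delta>[of n] by (intro ramp_eq_1, simp add: divide_simps, intro ramp_eq_0, simp add: divide_simps)
          then show ?case unfolding \<phi>_def using True by simp
        qed
      next
        case False
        have "\<phi> n t = 0" for n unfolding \<phi>_def using \<delta>[of n] False
          by (subst (1 2) ramp_eq_1) (auto simp: divide_simps)
        then show ?thesis using False by simp
      qed
      then show "(\<lambda>n. \<phi> n t *\<^sub>R g t) \<longlonglongrightarrow> indicator {..<b} t *\<^sub>R g t"
        by (intro tendsto_scaleR tendsto_const tendsto_eventually)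
    qed
  qed
  have "x 0 - x b = - (LINT t|meas_I T. indicator {..<b} t *\<^sub>R g t)"
    using LIMSEQ_unique[OF lim1[unfolded eq] tendsto_minus[OF lim2]] .
  then show ?thesis by (simp add: algebra_simps)
qed


section \<open>Uniqueness of weak derivatives and the energy identity\<close>

text \<open>
  The sets over which \<open>h\<close> integrates to zero form a Dynkin system containing the half-lines
  \<open>{..<a}\<close>, hence all Borel sets, and each Lebesgue set is a Borel set up to a null set.
\<close>

lemma AE_zero_if_initial_integrals_zero:
  fixes h :: "real \<Rightarrow> 'b::{banach, second_countable_topology}"
  assumes T: "0 < T" and h: "integrable (meas_I T) h"
    and zero: "\<And>b. b \<in> {0..T} \<Longrightarrow> (LINT t|meas_I T. indicator {..<b} t *\<^sub>R h t) = 0"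
  shows "AE t in meas_I T. h t = 0"
proof -
  let ?N = "meas_I T" and ?P = "\<lambda>A. (LINT t:A \<inter> {0<..<T}|meas_I T. h t) = 0"
  have inN: "A \<inter> {0<..<T} \<in> sets ?N" if "A \<in> sets lebesgue" for A
    using that by (auto simp: sets_restrict_space)
  have setint: "set_integrable ?N A h" if "A \<in> sets ?N" for A
    unfolding set_integrable_def using that h by (rule integrable_mult_indicator)
  have total: "(LINT t|?N. h t) = 0"
  proof -
    have "(LINT t|?N. h t) = (LINT t|?N. indicator {..<T} t *\<^sub>R h t)"
      by (rule Bochner_Integration.integral_cong) auto
    then show ?thesis using zero[of T] T by simp
  qed
  have basic: "?P {..<a}" for a
  proof -
    have eq: "(LINT t:{..<a} \<inter> {0<..<T}|?N. h t) = (LINT t|?N. indicator {..<max 0 (min a T)} t *\<^sub>R h t)"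
      unfolding set_lebesgue_integral_def
      by (intro Bochner_Integration.integral_cong refl) (auto simp: indicator_def)
    show ?thesis unfolding eq by (rule zero) (use T in auto)
  qed
  have borel: "?P A" if A: "A \<in> sets borel" for A :: "real set"
  proof -
    have "Int_stable (range (lessThan :: real \<Rightarrow> _))"
    proof (rule Int_stableI)
      show "a \<inter> b \<in> range lessThan" if "a \<in> range lessThan" "b \<in> range lessThan" for a b :: "real set"
      proof -
        from that obtain u v where "a = {..<u}" "b = {..<v}" by (blast elim: rangeE)
        then have "a \<inter> b = {..<min u v}" by auto
        then show ?thesis by simp
      qed
    qed
    moreover have "range (lessThan :: real \<Rightarrow> _) \<subseteq> Pow UNIV" by simp
    moreover have "A \<in> sigma_sets UNIV (range (lessThan :: real \<Rightarrow> _))"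
      using A unfolding borel_Iio by simp
    ultimately show ?thesis
    proof (induction rule: sigma_sets_induct_disjoint)
      case (basic A)
      then show ?case using \<open>\<And>a. ?P {..<a}\<close> by blast
    next
      case empty
      show ?case by (simp add: set_lebesgue_integral_def)
    next
      case (compl A)
      then have A: "A \<in> sets borel" unfolding borel_Iio by simp
      have "(LINT t:(UNIV - A) \<inter> {0<..<T}|?N. h t) = (LINT t|?N. h t - indicator (A \<inter> {0<..<T}) t *\<^sub>R h t)"
        unfolding set_lebesgue_integral_def
        by (intro Bochner_Integration.integral_cong refl) (auto simp: indicator_def)
      also have "\<dots> = (LINT t|?N. h t) - (LINT t:A \<inter> {0<..<T}|?N. h t)"
        using setint[OF inN, of A] A h unfolding set_lebesgue_integral_def set_integrable_def
        by (intro Bochner_Integration.integral_diff) auto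
      finally show ?case using compl total by simp
    next
      case (union F)
      then have F: "F i \<in> sets borel" for i unfolding borel_Iio by auto
      have FN: "F i \<inter> {0<..<T} \<in> sets ?N" for i by (rule inN) (use F in simp)
      have disj: "i \<noteq> k \<Longrightarrow> F i \<inter> {0<..<T} \<inter> (F k \<inter> {0<..<T}) = {}" for i k
        using union(1) by (auto simp: disjoint_family_on_def)
      have eq: "(\<Union>i. F i) \<inter> {0<..<T} = (\<Union>i. F i \<inter> {0<..<T})" by auto
      have "(LINT t:(\<Union>i. F i \<inter> {0<..<T})|?N. h t) = (\<Sum>i. LINT t:F i \<inter> {0<..<T}|?N. h t)"
        using FN by (intro lebesgue_integral_countable_add disj setint sets.countable_UN) auto
      then show ?case unfolding eq using union by simp
    qed
  qed
  interpret finite_measure ?N by (rule finite_measure_meas_I)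
  show ?thesis
  proof (rule density_zero[OF h])
    fix A assume "A \<in> sets ?N"
    then have A: "A \<in> sets lebesgue" "A \<subseteq> {0<..<T}" by (auto simp: sets_restrict_space)
    then obtain S Z Z' where S: "A = S \<union> Z" "Z \<subseteq> Z'" "Z' \<in> null_sets lborel" "S \<in> sets lborel"
      by (auto elim: sets_completionE)
    have "AE t in lborel. t \<notin> Z'" using S(3) by (rule AE_not_in)
    from AE_completion[OF this] have "AE t in ?N. t \<notin> Z'"
      by (auto simp: AE_restrict_space_iff elim!: eventually_mono)
    moreover have "AE t in ?N. t \<in> space ?N" by (rule AE_space)
    ultimately have "AE t in ?N. indicator A t *\<^sub>R h t = indicator (S \<inter> {0<..<T}) t *\<^sub>R h t"
      by eventually_elim (use S(1,2) in \<open>auto simp: indicator_def\<close>)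
    then have "(LINT t:A|?N. h t) = (LINT t:S \<inter> {0<..<T}|?N. h t)"
      unfolding set_lebesgue_integral_def
      using setint[OF \<open>A \<in> sets ?N\<close>] setint[OF inN, of S] S(4)
      by (intro integral_cong_AE) (auto simp: set_integrable_def)
    then show "(LINT t:A|?N. h t) = 0" using borel[of S] S(4) by simp
  qed
qed

text \<open>
  The product rule for \<open>|X|\<^sup>2\<close> when \<open>X\<close> is only an indefinite integral. Writing
  \<open>W t\<close> for the integral of \<open>G\<close> over \<open>(0, t)\<close>, the integral of \<open>G t \<bullet> W t\<close> is the integral of the
  symmetric kernel \<open>G t \<bullet> G s\<close> over the triangle \<open>s < t\<close>. By Fubini's theorem this is half of its
  integral over the square, which is \<open>|X T - X 0|\<^sup>2\<close>.
\<close>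

lemma energy_identity:
  fixes X G :: "real \<Rightarrow> 'b::{banach, real_inner, second_countable_topology}"
  assumes T: "0 < T" and G: "integrable (meas_I T) G"
    and X: "\<And>t. t \<in> {0..T} \<Longrightarrow> X t = X 0 + (LINT s|meas_I T. indicator {..<t} s *\<^sub>R G s)"
  shows "2 * (LINT t|meas_I T. G t \<bullet> X t) = (norm (X T))\<^sup>2 - (norm (X 0))\<^sup>2"
proof -
  let ?N = "meas_I T"
  interpret N: finite_measure ?N by (rule finite_measure_meas_I)
  interpret NN: pair_sigma_finite ?N ?N ..
  have [measurable]: "G \<in> borel_measurable ?N" using G by simp
  have id[measurable]: "(\<lambda>t. t) \<in> borel_measurable ?N"
    by (rule borel_measurable_meas_I_continuous) simp
  have ind: "(\<lambda>s. indicator {..<t} s :: real) \<in> borel_measurable ?N" for t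
    by (intro measurable_restrict_space1 measurable_completion) simp
  have indG: "integrable ?N (\<lambda>s. indicator {..<t} s *\<^sub>R G s)" for t
    by (rule Bochner_Integration.integrable_bound[OF G]) (use ind[of t] in \<open>auto simp: indicator_def\<close>)
  define W where "W t = (LINT s|?N. indicator {..<t} s *\<^sub>R G s)" for t
  define D where "D = (LINT s|?N. G s)"
  define K where "K = (\<lambda>t s. if s < t then G t \<bullet> G s else 0)"
  have D: "D = X T - X 0"
  proof -
    have "(LINT s|?N. indicator {..<T} s *\<^sub>R G s) = D"
      unfolding D_def by (rule Bochner_Integration.integral_cong) auto
    then show ?thesis using X[of T] T by simp
  qed
  have intprod: "integrable (?N \<Otimes>\<^sub>M ?N) (\<lambda>p. norm (G (fst p)) * norm (G (snd p)))"
  proof (rule NN.Fubini_integrable)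
    show "(\<lambda>p. norm (G (fst p)) * norm (G (snd p))) \<in> borel_measurable (?N \<Otimes>\<^sub>M ?N)" by measurable
    show "integrable ?N (\<lambda>t. LINT s|?N. norm (norm (G (fst (t, s))) * norm (G (snd (t, s)))))"
      using G by simp
    show "AE t in ?N. integrable ?N (\<lambda>s. norm (G (fst (t, s))) * norm (G (snd (t, s))))"
      using G by simp
  qed
  have intK: "integrable (?N \<Otimes>\<^sub>M ?N) (case_prod K)"
  proof (rule Bochner_Integration.integrable_bound[OF intprod])
    show "case_prod K \<in> borel_measurable (?N \<Otimes>\<^sub>M ?N)" unfolding K_def by measurable
    show "AE p in ?N \<Otimes>\<^sub>M ?N. norm (case_prod K p) \<le> norm (norm (G (fst p)) * norm (G (snd p)))"
      by (rule AE_I2) (auto simp: K_def Cauchy_Schwarz_ineq2 split: prod.split)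
  qed
  have inner1: "(LINT s|?N. K t s) = G t \<bullet> W t" for t
  proof -
    have "(LINT s|?N. K t s) = (LINT s|?N. G t \<bullet> (indicator {..<t} s *\<^sub>R G s))"
      by (rule Bochner_Integration.integral_cong) (auto simp: K_def)
    also have "\<dots> = G t \<bullet> W t" unfolding W_def by (rule integral_inner_right) (rule indG)
    finally show ?thesis .
  qed
  \<comment> \<open>Integrating over \<open>t\<close> first leaves the complementary half-line \<open>t > s\<close>; the point \<open>t = s\<close> is null.\<close>
  have inner2: "(LINT t|?N. K t s) = G s \<bullet> D - G s \<bullet> W s" for s
  proof -
    have "AE t in lebesgue. t \<noteq> s" by (rule AE_completion[OF AE_lborel_singleton])
    then have "AE t in ?N. t \<noteq> s" by (auto simp: AE_restrict_space_iff elim!: eventually_mono)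
    then have "(LINT t|?N. K t s) = (LINT t|?N. G s \<bullet> (G t - indicator {..<s} t *\<^sub>R G t))"
      unfolding K_def using ind[of s]
      by (intro integral_cong_AE) (auto simp: inner_commute indicator_def)
    also have "\<dots> = G s \<bullet> (D - W s)"
      unfolding D_def W_def using G indG by simp
    finally show ?thesis by (simp add: inner_diff_right)
  qed
  have intGD: "integrable ?N (\<lambda>s. G s \<bullet> c)" for c using G by simp
  have intGW: "integrable ?N (\<lambda>t. G t \<bullet> W t)"
    using NN.integrable_fst[OF intK] unfolding inner1 .
  have "(LINT t|?N. G t \<bullet> W t) = (LINT s|?N. G s \<bullet> D - G s \<bullet> W s)"
    using NN.Fubini_integral[OF intK] unfolding inner1 inner2 by simp
  also have "\<dots> = D \<bullet> D - (LINT t|?N. G t \<bullet> W t)"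
    using intGD[of D] intGW G by (simp add: D_def)
  finally have twice: "2 * (LINT t|?N. G t \<bullet> W t) = D \<bullet> D" by simp
  have "(LINT t|?N. G t \<bullet> X t) = (LINT t|?N. G t \<bullet> X 0 + G t \<bullet> W t)"
  proof (rule Bochner_Integration.integral_cong)
    fix t assume "t \<in> space ?N"
    then have "X t = X 0 + W t" unfolding W_def by (intro X) auto
    then show "G t \<bullet> X t = G t \<bullet> X 0 + G t \<bullet> W t" by (simp only: inner_add_right)
  qed simp
  also have "\<dots> = D \<bullet> X 0 + (LINT t|?N. G t \<bullet> W t)"
    using intGD[of "X 0"] intGW G by (simp add: D_def)
  finally show ?thesis using twice
    unfolding D power2_norm_eq_inner by (simp add: inner_diff_left inner_diff_right inner_commute)
qed

lemma test_fun_bounded: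
  assumes "test_fun T \<phi>"
  obtains c where "\<And>t. t \<in> {0<..<T} \<Longrightarrow> \<bar>\<phi> t\<bar> \<le> c" "\<And>t. t \<in> {0<..<T} \<Longrightarrow> \<bar>deriv \<phi> t\<bar> \<le> c"
    "\<phi> \<in> borel_measurable (meas_I T)" "deriv \<phi> \<in> borel_measurable (meas_I T)"
proof -
  obtain D where D: "\<And>t. (\<phi> has_real_derivative D t) (at t)" "continuous_on UNIV D"
    using assms unfolding test_fun_def C1_differentiable_on_def
    by (auto simp: has_real_derivative_iff_has_vector_derivative)
  have dD: "deriv \<phi> = D" using D(1) DERIV_imp_deriv by blast
  have c\<phi>: "continuous_on UNIV \<phi>" using D(1) by (meson DERIV_continuous continuous_at_imp_continuous_on)
  have "bounded (\<phi> ` {0..T} \<union> D ` {0..T})"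
    using c\<phi> D(2) by (intro bounded_Un[THEN iffD2] conjI compact_imp_bounded compact_continuous_image)
      (auto intro: continuous_on_subset)
  then obtain c where c: "\<And>y. y \<in> \<phi> ` {0..T} \<union> D ` {0..T} \<Longrightarrow> norm y \<le> c" unfolding bounded_iff by blast
  show ?thesis
  proof
    show "\<bar>\<phi> t\<bar> \<le> c" "\<bar>deriv \<phi> t\<bar> \<le> c" if "t \<in> {0<..<T}" for t
      using c[of "\<phi> t"] c[of "D t"] that unfolding dD by auto
  qed (use borel_measurable_meas_I_continuous[OF c\<phi>] borel_measurable_meas_I_continuous[OF D(2)] dD in auto)
qed

lemma integrable_test_fun_scaleR:
  fixes x :: "real \<Rightarrow> 'b::{banach, second_countable_topology}"
  assumes "test_fun T \<phi>" "x \<in> L2 T"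
  shows "integrable (meas_I T) (\<lambda>t. \<phi> t *\<^sub>R x t)" "integrable (meas_I T) (\<lambda>t. deriv \<phi> t *\<^sub>R x t)"
  using test_fun_bounded[OF assms(1)] integrable_bounded_scaleR_L2[OF assms(2)] by metis+

lemma has_weak_deriv_bounded_linear:
  fixes x g :: "real \<Rightarrow> 'b::{banach, second_countable_topology}"
    and h :: "'b \<Rightarrow> 'c::{banach, second_countable_topology}"
  assumes x: "x \<in> L2 T" and g: "g \<in> L2 T" and wd: "has_weak_deriv T x g" and h: "bounded_linear h"
  shows "has_weak_deriv T (\<lambda>t. h (x t)) (\<lambda>t. h (g t))"
  unfolding has_weak_deriv_def
proof (intro allI impI)
  fix \<phi> assume \<phi>: "test_fun T \<phi>"
  interpret h: bounded_linear h by fact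
  have "(LINT t|meas_I T. deriv \<phi> t *\<^sub>R h (x t)) = h (LINT t|meas_I T. deriv \<phi> t *\<^sub>R x t)"
    using integral_bounded_linear[OF h integrable_test_fun_scaleR(2)[OF \<phi> x]] by (simp add: h.scaleR)
  also have "\<dots> = - h (LINT t|meas_I T. \<phi> t *\<^sub>R g t)"
    using wd \<phi> unfolding has_weak_deriv_def by (simp add: h.neg)
  also have "h (LINT t|meas_I T. \<phi> t *\<^sub>R g t) = (LINT t|meas_I T. \<phi> t *\<^sub>R h (g t))"
    using integral_bounded_linear[OF h integrable_test_fun_scaleR(1)[OF \<phi> g]] by (simp add: h.scaleR)
  finally show "(LINT t|meas_I T. deriv \<phi> t *\<^sub>R h (x t)) = - (LINT t|meas_I T. \<phi> t *\<^sub>R h (g t))" .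
qed

lemma has_weak_deriv_add:
  fixes x y :: "real \<Rightarrow> 'b::{banach, second_countable_topology}"
  assumes "x \<in> L2 T" "g \<in> L2 T" "has_weak_deriv T x g" "y \<in> L2 T" "k \<in> L2 T" "has_weak_deriv T y k"
  shows "has_weak_deriv T (\<lambda>t. x t + y t) (\<lambda>t. g t + k t)"
  unfolding has_weak_deriv_def
proof (intro allI impI)
  fix \<phi> assume \<phi>: "test_fun T \<phi>"
  note i = integrable_test_fun_scaleR[OF \<phi>]
  show "(LINT t|meas_I T. deriv \<phi> t *\<^sub>R (x t + y t)) = - (LINT t|meas_I T. \<phi> t *\<^sub>R (g t + k t))"
    using assms(3,6) \<phi> unfolding has_weak_deriv_def
    by (simp add: scaleR_add_right i assms)
qed

lemma H1_weak_deriv: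
  assumes "x \<in> H1 T"
  shows "weak_deriv T x \<in> L2 T" "has_weak_deriv T x (weak_deriv T x)"
proof -
  have "\<exists>g. g \<in> L2 T \<and> has_weak_deriv T x g" using assms unfolding H1_def by blast
  from someI_ex[OF this] show "weak_deriv T x \<in> L2 T" "has_weak_deriv T x (weak_deriv T x)"
    unfolding weak_deriv_def by auto
qed

lemma H1_add:
  assumes "x \<in> H1 T" "y \<in> H1 T"
  shows "(\<lambda>t. x t + y t) \<in> H1 T"
  unfolding H1_def
proof (intro CollectI conjI bexI)
  note x = H1_weak_deriv[OF assms(1)] and y = H1_weak_deriv[OF assms(2)]
  have L2: "x \<in> L2 T" "y \<in> L2 T" using assms by (auto simp: H1_def)
  show "has_weak_deriv T (\<lambda>t. x t + y t) (\<lambda>t. weak_deriv T x t + weak_deriv T y t)"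
    by (rule has_weak_deriv_add[OF L2(1) x L2(2) y])
  show "(\<lambda>t. weak_deriv T x t + weak_deriv T y t) \<in> L2 T" by (rule L2_add[OF x(1) y(1)])
  show "(\<lambda>t. x t + y t) \<in> L2 T" by (rule L2_add[OF L2])
  show "continuous_on {0..T} (\<lambda>t. x t + y t)"
    using assms by (intro continuous_on_add) (auto simp: H1_def)
  show "\<forall>t. t \<notin> {0..T} \<longrightarrow> x t + y t = 0" using assms by (auto simp: H1_def)
qed

lemma H1_bounded_linear:
  fixes h :: "'b::{banach, second_countable_topology} \<Rightarrow> 'c::{banach, second_countable_topology}"
  assumes "x \<in> H1 T" "bounded_linear h"
  shows "(\<lambda>t. h (x t)) \<in> H1 T"
  unfolding H1_def
proof (intro CollectI conjI bexI)
  note x = H1_weak_deriv[OF assms(1)]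
  have L2: "x \<in> L2 T" using assms by (simp add: H1_def)
  show "has_weak_deriv T (\<lambda>t. h (x t)) (\<lambda>t. h (weak_deriv T x t))"
    by (rule has_weak_deriv_bounded_linear[OF L2 x assms(2)])
  show "(\<lambda>t. h (weak_deriv T x t)) \<in> L2 T" by (rule L2_bounded_linear[OF x(1) assms(2)])
  show "(\<lambda>t. h (x t)) \<in> L2 T" by (rule L2_bounded_linear[OF L2 assms(2)])
  show "continuous_on {0..T} (\<lambda>t. h (x t))"
    using assms(1) by (intro bounded_linear.continuous_on[OF assms(2)]) (simp add: H1_def)
  show "\<forall>t. t \<notin> {0..T} \<longrightarrow> h (x t) = 0"
    using assms(1) linear_0[OF bounded_linear.linear[OF assms(2)]] by (simp add: H1_def)
qed

lemma H1_diff: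
  assumes "x \<in> H1 T" "y \<in> H1 T"
  shows "(\<lambda>t. x t - y t) \<in> H1 T"
  using H1_add[OF assms(1) H1_bounded_linear[OF assms(2) bounded_linear_minus[OF bounded_linear_ident]]]
  by simp

lemma H1_sum:
  fixes x :: "'i \<Rightarrow> real \<Rightarrow> 'b::{banach, second_countable_topology}"
  assumes "\<And>i. i \<in> I \<Longrightarrow> x i \<in> H1 T"
  shows "(\<lambda>t. \<Sum>i\<in>I. x i t) \<in> H1 T"
proof -
  have L2: "(\<lambda>t. 0 :: 'b) \<in> L2 T" by (simp add: L2_iff)
  then have 0: "(\<lambda>t. 0 :: 'b) \<in> H1 T"
    unfolding H1_def has_weak_deriv_def by (intro CollectI conjI bexI[OF _ L2]) auto
  show ?thesis using assms
  proof (induction I rule: infinite_finite_induct)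
    case (insert i I)
    then show ?case using H1_add[of "x i" T "\<lambda>t. \<Sum>i\<in>I. x i t"] by simp
  qed (simp_all add: 0)
qed

lemma Xh_H1:
  fixes x :: "real \<Rightarrow> 'v::{banach, second_countable_topology}"
  assumes "x \<in> Xh T Vh" "subspace Vh"
  shows "x \<in> H1 T" "x t \<in> Vh"
proof -
  obtain n v s where *: "\<And>i. i < n \<Longrightarrow> v i \<in> Vh" "\<And>i. i < n \<Longrightarrow> s i \<in> H1 T" "x = (\<lambda>t. \<Sum>i<(n::nat). s i t *\<^sub>R v i)"
    using assms(1) unfolding tensor_def by blast
  show "x \<in> H1 T" unfolding *(3)
    using *(2) by (intro H1_sum H1_bounded_linear[OF _ bounded_linear_scaleR_left]) auto
  show "x t \<in> Vh" unfolding *(3)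
    using *(1) by (intro subspace_sum[OF assms(2)] subspace_scale[OF assms(2)]) auto
qed

text \<open>
  Any two weak derivatives have the same integrals over all intervals \<open>(0, b)\<close>, namely
  \<open>x b - x 0\<close>.
\<close>

lemma weak_deriv_AE_unique:
  fixes x :: "real \<Rightarrow> 'b::{banach, second_countable_topology}"
  assumes T: "0 < T" and x: "x \<in> H1 T" and g: "g \<in> L2 T" "has_weak_deriv T x g"
  shows "AE t in meas_I T. weak_deriv T x t = g t"
proof -
  note w = H1_weak_deriv[OF x]
  have x': "x \<in> L2 T" "continuous_on {0..T} x" using x by (auto simp: H1_def)
  have ind: "integrable (meas_I T) (\<lambda>t. indicator {..<b} t *\<^sub>R k t)" if "k \<in> L2 T" for b and k :: "real \<Rightarrow> 'b"
    by (rule integrable_bounded_scaleR_L2[OF that, of _ 1])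
      (auto intro!: measurable_restrict_space1 measurable_completion simp: indicator_def)
  have "AE t in meas_I T. weak_deriv T x t - g t = 0"
  proof (rule AE_zero_if_initial_integrals_zero[OF T integrable_L2[OF L2_diff[OF w(1) g(1)]]])
    fix b assume b: "b \<in> {0..T}"
    have "(LINT t|meas_I T. indicator {..<b} t *\<^sub>R (weak_deriv T x t - g t)) =
        (LINT t|meas_I T. indicator {..<b} t *\<^sub>R weak_deriv T x t) - (LINT t|meas_I T. indicator {..<b} t *\<^sub>R g t)"
      unfolding scaleR_diff_right by (rule Bochner_Integration.integral_diff[OF ind[OF w(1)] ind[OF g(1)]])
    also have "\<dots> = 0"
      using weak_deriv_integral[OF x' w b] weak_deriv_integral[OF x' g b] by simp
    finally show "(LINT t|meas_I T. indicator {..<b} t *\<^sub>R (weak_deriv T x t - g t)) = 0" .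
  qed
  then show ?thesis by eventually_elim simp
qed

lemma weak_deriv_diff:
  fixes x y :: "real \<Rightarrow> 'b::{banach, second_countable_topology}"
  assumes T: "0 < T" and x: "x \<in> H1 T" and y: "y \<in> H1 T"
  shows "AE t in meas_I T. weak_deriv T (\<lambda>t. x t - y t) t = weak_deriv T x t - weak_deriv T y t"
proof (rule weak_deriv_AE_unique[OF T H1_diff[OF x y]])
  note w = H1_weak_deriv[OF x] H1_weak_deriv[OF y]
  show "(\<lambda>t. weak_deriv T x t - weak_deriv T y t) \<in> L2 T" by (rule L2_diff[OF w(1,3)])
  have m: "bounded_linear (uminus :: 'b \<Rightarrow> 'b)" by (rule bounded_linear_minus[OF bounded_linear_ident])
  have L2: "x \<in> L2 T" "y \<in> L2 T" using x y by (auto simp: H1_def)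
  show "has_weak_deriv T (\<lambda>t. x t - y t) (\<lambda>t. weak_deriv T x t - weak_deriv T y t)"
    using has_weak_deriv_add[OF L2(1) w(1,2) L2_bounded_linear[OF L2(2) m] L2_bounded_linear[OF w(3) m]
        has_weak_deriv_bounded_linear[OF L2(2) w(3,4) m]] by simp
qed


section \<open>Equivalence of the residual energy and the norm of the trial space\<close>

lemma dual_norm_cong: "(\<And>w. w \<in> Vh \<Longrightarrow> \<phi> w = \<psi> w) \<Longrightarrow> dual_norm Vh \<phi> = dual_norm Vh \<psi>"
  unfolding dual_norm_def by simp

lemma dual_norm_uminus:
  assumes "subspace Vh" "linear \<phi>"
  shows "dual_norm Vh (\<lambda>w. - \<phi> w) = dual_norm Vh \<phi>"
proof -
  have "uminus ` Vh = Vh"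
    using subspace_neg[OF assms(1)] by (auto intro!: image_eqI[of _ uminus "- v" for v])
  then have "(\<lambda>w. - \<phi> w / norm w) ` Vh = (\<lambda>w. - \<phi> w / norm w) ` (uminus ` Vh)" by simp
  also have "\<dots> = (\<lambda>w. \<phi> w / norm w) ` Vh"
    unfolding image_image by (simp add: linear_neg[OF assms(2)])
  finally show ?thesis unfolding dual_norm_def by simp
qed

text \<open>
  The dual norm of an arbitrary family of functionals need not be measurable in time; its norm is
  then the default value zero of the integral, for both families at once.
\<close>

lemma Yh'_norm_cong_AE:
  assumes "AE t in meas_I T. \<forall>w\<in>Vh. F t w = G t w"
  shows "Yh'_norm T Vh F = Yh'_norm T Vh G"
proof -
  have eq: "AE t in meas_I T. (dual_norm Vh (F t))\<^sup>2 = (dual_norm Vh (G t))\<^sup>2"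
    using assms by eventually_elim (metis dual_norm_cong)
  have sym: "AE t in meas_I T. (dual_norm Vh (G t))\<^sup>2 = (dual_norm Vh (F t))\<^sup>2"
    using eq by eventually_elim simp
  have "(LINT t|meas_I T. (dual_norm Vh (F t))\<^sup>2) = (LINT t|meas_I T. (dual_norm Vh (G t))\<^sup>2)"
  proof (cases "(\<lambda>t. (dual_norm Vh (F t))\<^sup>2) \<in> borel_measurable (meas_I T)")
    case True
    then show ?thesis using borel_measurable_meas_I_AE[OF True eq] eq by (intro integral_cong_AE)
  next
    case False
    then have "(\<lambda>t. (dual_norm Vh (G t))\<^sup>2) \<notin> borel_measurable (meas_I T)"
      using borel_measurable_meas_I_AE[OF _ sym] by blast
    with False show ?thesis
      by (metis borel_measurable_integrable not_integrable_integral_eq)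
  qed
  then show ?thesis unfolding Yh'_norm_def by simp
qed

lemma Yh'_norm_riesz:
  assumes "\<And>t. r t \<in> Vh" "\<And>t v. v \<in> Vh \<Longrightarrow> F t v = r t \<bullet> v"
  shows "(Yh'_norm T Vh F)\<^sup>2 = (LINT t|meas_I T. (norm (r t))\<^sup>2)"
proof -
  have "dual_norm Vh (F t) = norm (r t)" for t by (rule dual_norm_riesz[OF assms])
  then show ?thesis unfolding Yh'_norm_def by (simp add: integral_nonneg)
qed

lemma linear_Ah: "linear (Ah T j A x t)"
  unfolding Ah_def
  by (rule linearI) (simp_all add: blinfun.add_right blinfun.scaleR_right inner_add_right algebra_simps)

text \<open>
  Measurability of \<open>A\<close> is given for fixed arguments only. Expanding \<open>x t\<close> in the basis reduces the
  argument that varies with time to finitely many fixed ones.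
\<close>

lemma operator_component_L2:
  fixes A :: "real \<Rightarrow> 'v::{banach, real_inner, second_countable_topology} \<Rightarrow>\<^sub>L ('v \<Rightarrow>\<^sub>L real)"
  assumes A_meas: "\<And>v. strongly_measurable (meas_I T) (\<lambda>t. A t v)"
    and A_bounded: "AE t in meas_I T. \<forall>v. norm (A t v) \<le> M * norm v"
    and E: "finite E" "\<And>e e'. e \<in> E \<Longrightarrow> e' \<in> E \<Longrightarrow> e \<bullet> e' = (if e = e' then 1 else 0)"
    and x: "x \<in> L2 T" "\<And>t. x t \<in> span E"
  shows "(\<lambda>t. A t (x t) w) \<in> L2 T"
proof (rule L2_bound[OF _ x(1)])
  have [measurable]: "(\<lambda>t. A t v w) \<in> borel_measurable (meas_I T)" for v
    by (rule strongly_measurable_borel_measurable)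
      (rule strongly_measurable_compose[OF A_meas], intro linear_continuous_on blinfun.bounded_linear_left)
  have [measurable]: "x \<in> borel_measurable (meas_I T)" using x(1) L2_iff by blast
  have "A t (x t) w = (\<Sum>e\<in>E. (x t \<bullet> e) * A t e w)" for t
  proof -
    have "A t (x t) w = A t (\<Sum>e\<in>E. (x t \<bullet> e) *\<^sub>R e) w"
      using orthonormal_expansion[OF E x(2)] by simp
    then show ?thesis by (simp add: blinfun.sum_right blinfun.sum_left blinfun.scaleR_right blinfun.scaleR_left)
  qed
  then show "(\<lambda>t. A t (x t) w) \<in> borel_measurable (meas_I T)" by simp
  show "AE t in meas_I T. norm (A t (x t) w) \<le> (M * norm w) * norm (x t)"
    using A_bounded
  proof eventually_elim
    case (elim t)
    have "norm (A t (x t) w) \<le> norm (A t (x t)) * norm w" by (rule norm_blinfun)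
    also have "\<dots> \<le> (M * norm (x t)) * norm w" using elim by (intro mult_right_mono) auto
    finally show ?case by (simp add: mult_ac)
  qed
qed

text \<open>
  Twice the least-squares functional for vanishing data.
\<close>

definition residual_energy ::
  "real \<Rightarrow> (('v::{banach, real_inner, second_countable_topology}) \<Rightarrow>\<^sub>L
    ('l::{banach, real_inner, second_countable_topology})) \<Rightarrow>
   (real \<Rightarrow> 'v \<Rightarrow>\<^sub>L ('v \<Rightarrow>\<^sub>L real)) \<Rightarrow> 'v set \<Rightarrow> real \<Rightarrow> (real \<Rightarrow> 'v) \<Rightarrow> real" where
  "residual_energy T j A Vh \<alpha> x = (Yh'_norm T Vh (Ah T j A x))\<^sup>2 + \<alpha> * (norm (j (x 0)))\<^sup>2"

text \<open>
  Let \<open>r t\<close> and \<open>a t\<close> be the Riesz representatives in \<open>V\<^sub>h\<close> of the time derivative and of \<open>A t (x t)\<close>.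
  The energy identity turns the initial value into the final one, so the residual energy is the
  integral of \<open>|r + a|\<^sup>2 - 2 \<alpha> r \<bullet> x\<close> plus \<open>\<alpha> |x(T)|\<^sup>2\<close>. Its integrand is compared pointwise with that of
  the norm of \<open>X\<^sub>h\<close>, and its last term directly.
\<close>

lemma residual_energy_bounds:
  fixes j :: "('v::{banach, real_inner, second_countable_topology}) \<Rightarrow>\<^sub>L
              ('l::{banach, real_inner, second_countable_topology})"
    and A :: "real \<Rightarrow> 'v \<Rightarrow>\<^sub>L ('v \<Rightarrow>\<^sub>L real)"
  assumes T: "0 < T" and \<alpha>: "0 < \<alpha>" "\<alpha> \<le> M"
    and A_meas: "\<And>v. strongly_measurable (meas_I T) (\<lambda>t. A t v)"
    and A_bounded: "AE t in meas_I T. \<forall>v. norm (A t v) \<le> M * norm v"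
    and A_coercive: "AE t in meas_I T. \<forall>v. A t v v \<ge> \<alpha> * (norm v)\<^sup>2"
    and E: "finite E" "\<And>e e'. e \<in> E \<Longrightarrow> e' \<in> E \<Longrightarrow> e \<bullet> e' = (if e = e' then 1 else 0)"
    and Vh: "span E = Vh"
    and x: "x \<in> H1 T" "\<And>t. x t \<in> Vh"
  shows "\<alpha>\<^sup>2 / 2 * (Xh_norm T j Vh \<alpha> M x)\<^sup>2 \<le> residual_energy T j A Vh \<alpha> x" (is ?lower)
    and "residual_energy T j A Vh \<alpha> x \<le> 3 / 2 * (M ^ 4 / \<alpha>\<^sup>2) * (Xh_norm T j Vh \<alpha> M x)\<^sup>2" (is ?upper)
proof -
  let ?N = "meas_I T"
  define g where "g = weak_deriv T x"
  have g: "g \<in> L2 T" "has_weak_deriv T x g" unfolding g_def by (rule H1_weak_deriv[OF x(1)])+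
  have xL2: "x \<in> L2 T" "continuous_on {0..T} x" using x(1) by (auto simp: H1_def)
  have jbl: "bounded_linear (blinfun_apply j)" by (rule blinfun.bounded_linear_right)
  define r where "r t = (\<Sum>e\<in>E. (j (g t) \<bullet> j e) *\<^sub>R e)" for t
  define a where "a t = (\<Sum>e\<in>E. A t (x t) e *\<^sub>R e)" for t
  have in_Vh: "r t \<in> Vh" "a t \<in> Vh" for t
    unfolding r_def a_def Vh[symmetric] by (intro span_sum span_mul span_base; assumption)+
  have r: "j (g t) \<bullet> j w = r t \<bullet> w" if "w \<in> Vh" for t w
    unfolding r_def
    by (rule riesz_span[OF E])
      (use that Vh in \<open>auto intro!: linearI simp: blinfun.add_right blinfun.scaleR_right inner_add_right\<close>)
  have a: "A t (x t) w = a t \<bullet> w" if "w \<in> Vh" for t w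
    unfolding a_def
    by (rule riesz_span[OF E])
      (use that Vh in \<open>auto intro!: linearI simp: blinfun.add_right blinfun.scaleR_right\<close>)
  have rL2: "r \<in> L2 T"
    unfolding r_def[abs_def]
    by (intro L2_sum L2_bounded_linear[OF g(1)] bounded_linear_compose[OF bounded_linear_scaleR_left]
        bounded_linear_compose[OF bounded_linear_inner_left] jbl)
  have aL2: "a \<in> L2 T"
    unfolding a_def[abs_def]
    by (intro L2_sum L2_bounded_linear[OF _ bounded_linear_scaleR_left]
        operator_component_L2[OF A_meas A_bounded E xL2(1)]) (use x(2) Vh in auto)
  have raL2: "(\<lambda>t. r t + a t) \<in> L2 T" by (rule L2_add[OF rL2 aL2])
  have sq: "integrable ?N (\<lambda>t. (norm (k t))\<^sup>2)" if "k \<in> L2 T" for k :: "real \<Rightarrow> 'v"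
    using that by (simp add: L2_iff)
  have rx: "integrable ?N (\<lambda>t. r t \<bullet> x t)" by (rule integrable_L2_inner[OF rL2 xL2(1)])
  have AhN: "(Yh'_norm T Vh (Ah T j A x))\<^sup>2 = (LINT t|?N. (norm (r t + a t))\<^sup>2)"
    by (rule Yh'_norm_riesz)
      (use in_Vh in \<open>auto simp: Ah_def g_def[symmetric] r a inner_add_left Vh[symmetric] span_add\<close>)
  have dN: "(Yh'_norm T Vh (\<lambda>t w. j (weak_deriv T x t) \<bullet> j w))\<^sup>2 = (LINT t|?N. (norm (r t))\<^sup>2)"
    by (rule Yh'_norm_riesz) (use in_Vh r in \<open>auto simp: g_def[symmetric]\<close>)
  have xN: "(L2_norm T x)\<^sup>2 = (LINT t|?N. (norm (x t))\<^sup>2)"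
    unfolding L2_norm_def by (simp add: integral_nonneg)
  define q where "q t = (norm (x t))\<^sup>2 + 1 / M\<^sup>2 * (norm (r t))\<^sup>2" for t
  define p where "p t = (norm (r t + a t))\<^sup>2 - 2 * \<alpha> * (r t \<bullet> x t)" for t
  have q: "integrable ?N q" unfolding q_def[abs_def]
    by (intro Bochner_Integration.integrable_add integrable_mult_right sq xL2(1) rL2)
  have p: "integrable ?N p" unfolding p_def[abs_def]
    by (intro Bochner_Integration.integrable_diff integrable_mult_right sq raL2 rx)
  have XhN: "(Xh_norm T j Vh \<alpha> M x)\<^sup>2 = (LINT t|?N. q t) + 1 / \<alpha> * (norm (j (x T)))\<^sup>2"
  proof -
    have "(LINT t|?N. q t) = (L2_norm T x)\<^sup>2 + 1 / M\<^sup>2 * (Yh'_norm T Vh (\<lambda>t w. j (weak_deriv T x t) \<bullet> j w))\<^sup>2"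
      unfolding q_def xN dN
      by (subst Bochner_Integration.integral_add) (auto intro!: sq xL2(1) rL2 integrable_divide_zero)
    then show ?thesis unfolding Xh_norm_def using \<alpha>(1) by simp
  qed
  have energy: "2 * (LINT t|?N. r t \<bullet> x t) = (norm (j (x T)))\<^sup>2 - (norm (j (x 0)))\<^sup>2"
  proof -
    have "2 * (LINT t|?N. j (g t) \<bullet> j (x t)) = (norm (j (x T)))\<^sup>2 - (norm (j (x 0)))\<^sup>2"
    proof (rule energy_identity[OF T])
      show "integrable ?N (\<lambda>t. j (g t))" by (rule integrable_L2[OF L2_bounded_linear[OF g(1) jbl]])
      fix t assume t: "t \<in> {0..T}"
      show "j (x t) = j (x 0) + (LINT s|?N. indicator {..<t} s *\<^sub>R j (g s))"
        by (rule weak_deriv_integral[OF _ _ _ has_weak_deriv_bounded_linear[OF xL2(1) g jbl] t])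
          (auto intro!: L2_bounded_linear[OF _ jbl] xL2 g continuous_intros)
    qed
    then show ?thesis using r[OF x(2)] by simp
  qed
  have resN: "residual_energy T j A Vh \<alpha> x = (LINT t|?N. p t) + \<alpha> * (norm (j (x T)))\<^sup>2"
  proof -
    have "(LINT t|?N. p t) = (LINT t|?N. (norm (r t + a t))\<^sup>2) - 2 * \<alpha> * (LINT t|?N. r t \<bullet> x t)"
      unfolding p_def using sq[OF raL2] rx by simp
    moreover have "2 * \<alpha> * (LINT t|?N. r t \<bullet> x t) = \<alpha> * ((norm (j (x T)))\<^sup>2 - (norm (j (x 0)))\<^sup>2)"
      unfolding energy[symmetric] by simp
    ultimately show ?thesis unfolding residual_energy_def AhN by (simp add: right_diff_distrib)
  qed
  have pw: "AE t in ?N. \<alpha>\<^sup>2 / 2 * q t \<le> p t \<and> p t \<le> 3 / 2 * (M ^ 4 / \<alpha>\<^sup>2) * q t"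
    using A_bounded A_coercive
  proof eventually_elim
    case (elim t)
    have c: "\<alpha> * (norm (x t))\<^sup>2 \<le> a t \<bullet> x t" using elim(2) a[OF x(2)] by metis
    have b: "norm (a t) \<le> M * norm (x t)"
    proof -
      have "(norm (a t))\<^sup>2 = A t (x t) (a t)" by (simp add: a[OF in_Vh(2)] power2_norm_eq_inner)
      also have "\<dots> \<le> norm (A t (x t)) * norm (a t)" using norm_blinfun[of "A t (x t)" "a t"] by simp
      also have "\<dots> \<le> (M * norm (x t)) * norm (a t)" using elim(1) by (intro mult_right_mono) auto
      finally show ?thesis
        by (cases "norm (a t) = 0") (use \<alpha> in \<open>auto simp: power2_eq_square\<close>)
    qed
    show ?case unfolding p_def q_def
      using residual_density_lower[OF \<alpha> c b] residual_density_upper[OF \<alpha> c b] by blast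
  qed
  have pwl: "AE t in ?N. \<alpha>\<^sup>2 / 2 * q t \<le> p t" using pw by (rule AE_mp) simp
  have pwu: "AE t in ?N. p t \<le> 3 / 2 * (M ^ 4 / \<alpha>\<^sup>2) * q t" using pw by (rule AE_mp) simp
  have "\<alpha>\<^sup>2 / 2 * (LINT t|?N. q t) = (LINT t|?N. \<alpha>\<^sup>2 / 2 * q t)" by simp
  also have "\<dots> \<le> (LINT t|?N. p t)"
    by (intro integral_mono_AE integrable_mult_right p q pwl)
  finally have low: "\<alpha>\<^sup>2 / 2 * (LINT t|?N. q t) \<le> (LINT t|?N. p t)" .
  have "(LINT t|?N. p t) \<le> (LINT t|?N. 3 / 2 * (M ^ 4 / \<alpha>\<^sup>2) * q t)"
    by (intro integral_mono_AE integrable_mult_right p q pwu)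
  then have upp: "(LINT t|?N. p t) \<le> 3 / 2 * (M ^ 4 / \<alpha>\<^sup>2) * (LINT t|?N. q t)" by simp
  have "\<alpha>\<^sup>2 / 2 * (1 / \<alpha> * (norm (j (x T)))\<^sup>2) \<le> \<alpha> * (norm (j (x T)))\<^sup>2"
    using \<alpha>(1) by (simp add: power2_eq_square)
  with low show ?lower unfolding XhN resN by (simp only: distrib_left add_mono)
  have "\<alpha> * \<alpha> ^ 3 \<le> 3 / 2 * M ^ 4"
  proof -
    have "\<alpha> * \<alpha> ^ 3 = \<alpha> ^ 4" by (simp add: eval_nat_numeral)
    moreover have "\<alpha> ^ 4 \<le> M ^ 4" using \<alpha> by (intro power_mono) auto
    moreover have "0 \<le> M ^ 4" by simp
    ultimately show ?thesis by linarith
  qed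
  then have "\<alpha> \<le> 3 / 2 * (M ^ 4 / \<alpha>\<^sup>2) * (1 / \<alpha>)"
    using \<alpha>(1) by (simp add: field_simps power2_eq_square power3_eq_cube)
  from mult_right_mono[OF this, of "(norm (j (x T)))\<^sup>2"]
  have "\<alpha> * (norm (j (x T)))\<^sup>2 \<le> 3 / 2 * (M ^ 4 / \<alpha>\<^sup>2) * (1 / \<alpha> * (norm (j (x T)))\<^sup>2)" by (simp add: mult.assoc)
  with upp show ?upper unfolding XhN resN by (simp only: distrib_left add_mono)
qed


section \<open>The semi-discrete solution has vanishing residual\<close>

lemma L_proj_mem:
  fixes j :: "('v::{banach, real_inner, second_countable_topology}) \<Rightarrow>\<^sub>L
              ('l::{banach, real_inner, second_countable_topology})"
  assumes inj: "inj (blinfun_apply j)" and Vh: "finite B" "Vh = span B"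
  shows "L_proj j Vh u0 \<in> Vh"
proof -
  have lin: "linear (blinfun_apply j)" by (rule bounded_linear.linear[OF blinfun.bounded_linear_right])
  have im: "blinfun_apply j ` Vh = span (blinfun_apply j ` B)" unfolding Vh(2) by (rule linear_span_image[OF lin, symmetric])
  obtain E where E: "finite E" "E \<subseteq> blinfun_apply j ` Vh" "span E = blinfun_apply j ` Vh"
    "\<And>e e'. e \<in> E \<Longrightarrow> e' \<in> E \<Longrightarrow> e \<bullet> e' = (if e = e' then 1 else 0)"
    using finite_span_orthonormal_basis[OF finite_imageI[OF Vh(1)] im] by metis
  define p' where "p' = (\<Sum>e\<in>E. (u0 \<bullet> e) *\<^sub>R e)"
  have "p' \<in> span E" unfolding p'_def by (intro span_sum span_mul span_base)
  then obtain p where p: "p \<in> Vh" "p' = j p" using E(3) by auto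
  have orth: "(u0 - j p) \<bullet> j w = 0" if "w \<in> Vh" for w
  proof -
    have "u0 \<bullet> j w = p' \<bullet> j w" unfolding p'_def
      by (rule riesz_span[OF E(1,4)])
        (use that E(3) in \<open>auto intro!: linearI simp: inner_add_right\<close>)
    then show ?thesis by (simp add: p(2) inner_diff_left)
  qed
  have "\<exists>!p. p \<in> Vh \<and> (\<forall>w\<in>Vh. (u0 - j p) \<bullet> j w = 0)"
  proof (rule ex1I)
    show "p \<in> Vh \<and> (\<forall>w\<in>Vh. (u0 - j p) \<bullet> j w = 0)" using p orth by blast
    fix q assume q: "q \<in> Vh \<and> (\<forall>w\<in>Vh. (u0 - j q) \<bullet> j w = 0)"
    have "p - q \<in> Vh" using p q Vh(2) by (simp add: span_diff)
    then have "(u0 - j q) \<bullet> j (p - q) - (u0 - j p) \<bullet> j (p - q) = 0" using q orth by simp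
    then have "j (p - q) \<bullet> j (p - q) = 0" by (simp add: blinfun.diff_right inner_diff_left)
    then have "j p = j q" by (simp add: blinfun.diff_right)
    then show "q = p" using inj by (auto dest: injD)
  qed
  from theI'[OF this] show ?thesis unfolding L_proj_def by blast
qed

lemma semidiscrete_solution_initial:
  assumes inj: "inj (blinfun_apply j)" and Vh: "finite B" "Vh = span B"
    and u: "semidiscrete_solution T j A Vh f u0 u"
  shows "u 0 = L_proj j Vh u0"
proof -
  let ?p = "L_proj j Vh u0"
  have sub: "subspace Vh" using Vh by simp
  have "u 0 \<in> Vh" using u Xh_H1(2)[OF _ sub] unfolding semidiscrete_solution_def by blast
  then have d: "u 0 - ?p \<in> Vh" using L_proj_mem[OF inj Vh] sub by (intro subspace_diff)
  have "(\<lambda>t. 0) \<in> Yh T Vh" using sub by (simp add: Yh_def L2_iff subspace_0)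
  then have "Bh T j A u (\<lambda>t. 0, u 0 - ?p) = Zh'_elem T j (load_h f) ?p (\<lambda>t. 0, u 0 - ?p)"
    using u d unfolding semidiscrete_solution_def by blast
  then have "j (u 0) \<bullet> j (u 0 - ?p) = j ?p \<bullet> j (u 0 - ?p)"
    unfolding Bh_def Zh'_elem_def by (simp add: Ah_def load_h_def blinfun.zero_right)
  then have "j (u 0 - ?p) \<bullet> j (u 0 - ?p) = 0" by (simp add: blinfun.diff_right inner_diff_left)
  then have "j (u 0) = j ?p" by (simp add: blinfun.diff_right)
  then show ?thesis using inj by (auto dest: injD)
qed

text \<open>
  Testing with \<open>F e\<close>, where \<open>F\<close> is the residual in the direction of a basis vector \<open>e\<close>, shows that the
  integral of \<open>F\<^sup>2\<close> vanishes.
\<close>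

lemma semidiscrete_solution_residual:
  fixes j :: "('v::{banach, real_inner, second_countable_topology}) \<Rightarrow>\<^sub>L
              ('l::{banach, real_inner, second_countable_topology})"
    and A :: "real \<Rightarrow> 'v \<Rightarrow>\<^sub>L ('v \<Rightarrow>\<^sub>L real)"
  assumes A_meas: "\<And>v. strongly_measurable (meas_I T) (\<lambda>t. A t v)"
    and A_bounded: "AE t in meas_I T. \<forall>v. norm (A t v) \<le> M * norm v"
    and f: "f \<in> L2 T"
    and E: "finite E" "\<And>e e'. e \<in> E \<Longrightarrow> e' \<in> E \<Longrightarrow> e \<bullet> e' = (if e = e' then 1 else 0)"
    and Vh: "span E = Vh"
    and u: "semidiscrete_solution T j A Vh f u0 u"
  shows "AE t in meas_I T. \<forall>w\<in>Vh. Ah T j A u t w = f t w"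
proof -
  let ?N = "meas_I T"
  have sub: "subspace Vh" using Vh by auto
  have uX: "u \<in> Xh T Vh" using u unfolding semidiscrete_solution_def by blast
  note uH = Xh_H1[OF uX sub]
  have uL2: "u \<in> L2 T" using uH(1) by (simp add: H1_def)
  have fL2: "(\<lambda>t. f t w) \<in> L2 T" for w
    by (rule L2_bounded_linear[OF f blinfun.bounded_linear_left])
  have AhL2: "(\<lambda>t. Ah T j A u t w) \<in> L2 T" for w
    unfolding Ah_def
    by (intro L2_add operator_component_L2[OF A_meas A_bounded E uL2]
        L2_bounded_linear[OF H1_weak_deriv(1)[OF uH(1)]]
        bounded_linear_compose[OF bounded_linear_inner_left blinfun.bounded_linear_right])
      (use uH(2) Vh in auto)
  have comp: "AE t in ?N. Ah T j A u t e - f t e = 0" if e: "e \<in> E" for e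
  proof -
    define F where "F t = Ah T j A u t e - f t e" for t
    have F: "F \<in> L2 T" unfolding F_def[abs_def] by (rule L2_diff[OF AhL2 fL2])
    have eVh: "e \<in> Vh" using e Vh span_base by blast
    have "(\<lambda>t. F t *\<^sub>R e) \<in> Yh T Vh"
      unfolding Yh_def using L2_bounded_linear[OF F bounded_linear_scaleR_left] subspace_scale[OF sub eVh] by simp
    then have "Bh T j A u (\<lambda>t. F t *\<^sub>R e, 0) = Zh'_elem T j (load_h f) (L_proj j Vh u0) (\<lambda>t. F t *\<^sub>R e, 0)"
      using u subspace_0[OF sub] unfolding semidiscrete_solution_def by blast
    then have "(LINT t|?N. Ah T j A u t (F t *\<^sub>R e)) = (LINT t|?N. f t (F t *\<^sub>R e))"
      unfolding Bh_def Zh'_elem_def by (simp add: load_h_def blinfun.zero_right)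
    then have "(LINT t|?N. F t \<bullet> Ah T j A u t e) = (LINT t|?N. F t \<bullet> f t e)"
      by (simp add: linear_scale[OF linear_Ah] blinfun.scaleR_right)
    moreover have "(LINT t|?N. F t \<bullet> F t) = (LINT t|?N. F t \<bullet> Ah T j A u t e) - (LINT t|?N. F t \<bullet> f t e)"
      using Bochner_Integration.integral_diff[OF integrable_L2_inner[OF F AhL2[of e]] integrable_L2_inner[OF F fL2[of e]]]
      unfolding inner_diff_right[symmetric] F_def[symmetric] .
    ultimately have "(LINT t|?N. F t \<bullet> F t) = 0" by simp
    then have "AE t in ?N. F t \<bullet> F t = 0"
      using integral_nonneg_eq_0_iff_AE[OF integrable_L2_inner[OF F F]] by simp
    then show ?thesis by (auto simp: F_def)
  qed
  have "AE t in ?N. \<forall>e\<in>E. Ah T j A u t e - f t e = 0"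
    using comp E(1) by (simp add: eventually_ball_finite)
  then show ?thesis
  proof eventually_elim
    case (elim t)
    have lin: "linear (\<lambda>w. Ah T j A u t w - f t w)"
      by (intro linear_compose_sub linear_Ah bounded_linear.linear blinfun.bounded_linear_right)
    show ?case
    proof
      fix w assume "w \<in> Vh"
      then have "Ah T j A u t w - f t w = (\<Sum>e\<in>E. (Ah T j A u t e - f t e) *\<^sub>R e) \<bullet> w"
        by (intro riesz_span[OF E lin]) (use Vh in auto)
      then show "Ah T j A u t w = f t w" using elim by simp
    qed
  qed
qed


section \<open>Quasi-optimality of the least-squares approximation\<close>

theorem lemma3p3:
  fixes j :: "('v::{banach, real_inner, second_countable_topology}) \<Rightarrow>\<^sub>L
              ('l::{banach, real_inner, second_countable_topology})"
    and T \<alpha> M :: real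
    and A :: "real \<Rightarrow> 'v \<Rightarrow>\<^sub>L ('v \<Rightarrow>\<^sub>L real)"
    and f :: "real \<Rightarrow> 'v \<Rightarrow>\<^sub>L real"
    and u0 :: 'l
    and P Q :: nat
    and \<mu> :: "nat \<Rightarrow> real \<Rightarrow> real" and Ap :: "nat \<Rightarrow> 'v \<Rightarrow>\<^sub>L ('v \<Rightarrow>\<^sub>L real)"
    and lam :: "nat \<Rightarrow> real \<Rightarrow> real" and fq :: "nat \<Rightarrow> 'v \<Rightarrow>\<^sub>L real"
    and Vh :: "'v set" and Sk :: "(real \<Rightarrow> real) set"
    and uh uhk :: "real \<Rightarrow> 'v"
  assumes gelfand: "gelfand_embedding j"
    and T_pos: "0 < T"
    and \<alpha>_M: "0 < \<alpha>" "\<alpha> \<le> M"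
    and A_meas: "\<And>v. strongly_measurable (meas_I T) (\<lambda>t. A t v)"
    and A_bounded: "AE t in meas_I T. \<forall>v. norm (A t v) \<le> M * norm v"
    and A_coercive: "AE t in meas_I T. \<forall>v. A t v v \<ge> \<alpha> * (norm v)\<^sup>2"
    and f_L2: "f \<in> L2 T"
    and PQ: "0 < P" "0 < Q"
    and \<mu>_Linfty: "\<And>p. p < P \<Longrightarrow> \<mu> p \<in> Linfty T"
    and A_affine: "AE t in meas_I T. A t = (\<Sum>p<P. \<mu> p t *\<^sub>R Ap p)"
    and lam_L2: "\<And>q. q < Q \<Longrightarrow> lam q \<in> L2 T"
    and f_affine: "AE t in meas_I T. f t = (\<Sum>q<Q. lam q t *\<^sub>R fq q)"
    and Vh: "subspace Vh" "\<exists>B. finite B \<and> Vh = span B"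
    and Sk: "fin_dim_fun_space Sk" "Sk \<subseteq> H1 T"
    and uh: "semidiscrete_solution T j A Vh f u0 uh"
    and uhk: "is_arg_min (energy_h T j A Vh \<alpha> f u0) (\<lambda>x. x \<in> tensor Vh Sk) uhk"
  shows "Xh_norm T j Vh \<alpha> M (\<lambda>t. uh t - uhk t)
           \<le> sqrt 3 * M / beta_const \<alpha> M T A *
             (INF xhk \<in> tensor Vh Sk. Xh_norm T j Vh \<alpha> M (\<lambda>t. uh t - xhk t))"
proof -
  let ?X = "\<lambda>x. Xh_norm T j Vh \<alpha> M (\<lambda>t. uh t - x t)"
  let ?R = "\<lambda>x. residual_energy T j A Vh \<alpha> (\<lambda>t. uh t - x t)"
  obtain B where B: "finite B" "Vh = span B" using Vh(2) by blast
  obtain E where E: "finite E" "span E = Vh"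
    "\<And>e e'. e \<in> E \<Longrightarrow> e' \<in> E \<Longrightarrow> e \<bullet> e' = (if e = e' then 1 else 0)"
    using finite_span_orthonormal_basis[OF B] by metis
  have inj: "inj (blinfun_apply j)" using gelfand by (simp add: gelfand_embedding_def)
  have uX: "uh \<in> Xh T Vh" using uh by (simp add: semidiscrete_solution_def)
  note u = Xh_H1[OF uX Vh(1)]
  have tensor_H1: "x \<in> H1 T" "\<And>t. x t \<in> Vh" if "x \<in> tensor Vh Sk" for x
  proof -
    have "x \<in> Xh T Vh" using that Sk(2) unfolding tensor_def by blast
    then show "x \<in> H1 T" "\<And>t. x t \<in> Vh" using Xh_H1[OF _ Vh(1)] by blast+
  qed
  have bounds: "\<alpha>\<^sup>2 / 2 * (?X x)\<^sup>2 \<le> ?R x" "?R x \<le> 3 / 2 * (M ^ 4 / \<alpha>\<^sup>2) * (?X x)\<^sup>2" if "x \<in> tensor Vh Sk" for x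
    using residual_energy_bounds[OF T_pos \<alpha>_M A_meas A_bounded A_coercive E(1,3,2) H1_diff[OF u(1) tensor_H1(1)[OF that]]]
      subspace_diff[OF Vh(1) u(2) tensor_H1(2)[OF that]] by blast+
  have residual_zero: "AE t in meas_I T. \<forall>w\<in>Vh. Ah T j A uh t w = f t w"
    by (rule semidiscrete_solution_residual[OF A_meas A_bounded f_L2 E(1) _ E(2) uh]) (rule E(3))
  have energy: "energy_h T j A Vh \<alpha> f u0 x = 1 / 2 * ?R x" if x: "x \<in> tensor Vh Sk" for x
  proof -
    have res: "AE t in meas_I T. \<forall>w\<in>Vh. Ah T j A x t w - load_h f t w = - Ah T j A (\<lambda>t. uh t - x t) t w"
      using weak_deriv_diff[OF T_pos u(1) tensor_H1(1)[OF x]] residual_zero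
    proof eventually_elim
      case (elim t)
      then show ?case
        by (auto simp: Ah_def load_h_def blinfun.diff_right blinfun.diff_left inner_diff_left)
    qed
    have "Yh'_norm T Vh (\<lambda>t w. Ah T j A x t w - load_h f t w) =
        Yh'_norm T Vh (\<lambda>t w. - Ah T j A (\<lambda>t. uh t - x t) t w)"
      using res by (rule Yh'_norm_cong_AE)
    also have "\<dots> = Yh'_norm T Vh (Ah T j A (\<lambda>t. uh t - x t))"
      unfolding Yh'_norm_def by (simp add: dual_norm_uminus[OF Vh(1) linear_Ah])
    finally show ?thesis
      unfolding energy_h_def residual_energy_def semidiscrete_solution_initial[OF inj B uh, symmetric]
      by (simp add: blinfun.diff_right norm_minus_commute)
  qed
  define C where "C = sqrt 3 * M / beta_const \<alpha> M T A"
  have M: "0 < M" using \<alpha>_M by simp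
  have \<beta>: "0 < beta_const \<alpha> M T A" "beta_const \<alpha> M T A \<le> \<alpha>\<^sup>2 / M"
  proof -
    define k where "k = 1 + (kappa T A)\<^sup>2"
    have k: "k \<ge> 1" unfolding k_def by simp
    then have "k powr (- 1 / 2) \<le> 1" "0 < k powr (- 1 / 2)" using powr_mono[of "- 1 / 2" 0 k] by auto
    then show "0 < beta_const \<alpha> M T A" "beta_const \<alpha> M T A \<le> \<alpha>\<^sup>2 / M"
      unfolding beta_const_def k_def[symmetric]
      using \<alpha>_M M mult_left_mono[of "k powr (- 1 / 2)" 1 "\<alpha>\<^sup>2 / M"] by auto
  qed
  have C: "sqrt 3 * M\<^sup>2 / \<alpha>\<^sup>2 \<le> C"
  proof -
    have "sqrt 3 * M\<^sup>2 / \<alpha>\<^sup>2 = sqrt 3 * M / (\<alpha>\<^sup>2 / M)" by (simp add: power2_eq_square)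
    also have "\<dots> \<le> C" unfolding C_def using \<beta> M \<alpha>_M(1) by (intro divide_left_mono) auto
    finally show ?thesis .
  qed
  have C0: "0 < C" unfolding C_def using \<beta>(1) M by simp
  have tensor_nonempty: "tensor Vh Sk \<noteq> {}"
    unfolding tensor_def by (auto intro: exI[of _ 0])
  have uhk_mem: "uhk \<in> tensor Vh Sk" using uhk by (simp add: is_arg_min_def)
  have quasi: "?X uhk \<le> C * ?X x" if x: "x \<in> tensor Vh Sk" for x
  proof -
    have "?R uhk \<le> ?R x"
      using uhk x uhk_mem energy by (auto simp: is_arg_min_def not_less)
    then have "\<alpha>\<^sup>2 / 2 * (?X uhk)\<^sup>2 \<le> 3 / 2 * (M ^ 4 / \<alpha>\<^sup>2) * (?X x)\<^sup>2"
      using bounds(1)[OF uhk_mem] bounds(2)[OF x] by linarith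
    then have "(?X uhk)\<^sup>2 \<le> (sqrt 3 * M\<^sup>2 / \<alpha>\<^sup>2 * ?X x)\<^sup>2"
      using \<alpha>_M(1) by (simp add: power_mult_distrib power_divide field_simps flip: power_mult)
    moreover have "0 \<le> ?X x" unfolding Xh_norm_def
      using \<alpha>_M by (intro real_sqrt_ge_zero add_nonneg_nonneg mult_nonneg_nonneg) auto
    ultimately have "?X uhk \<le> sqrt 3 * M\<^sup>2 / \<alpha>\<^sup>2 * ?X x"
      by (meson power2_le_imp_le mult_nonneg_nonneg divide_nonneg_nonneg real_sqrt_ge_zero zero_le_power2 zero_le_numeral)
    also have "\<dots> \<le> C * ?X x" using C \<open>0 \<le> ?X x\<close> by (rule mult_right_mono)
    finally show ?thesis .
  qed
  have "?X uhk / C \<le> (INF x \<in> tensor Vh Sk. ?X x)"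
    using quasi C0 by (intro cINF_greatest[OF tensor_nonempty]) (simp add: divide_le_eq mult.commute)
  then show ?thesis unfolding C_def[symmetric] using C0 by (simp add: divide_le_eq mult.commute)
qed

end
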